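(* Let $1<q<\infty$, $q\neq 2$, and let $(G,p)$ be a regular bar-joint framework in $(\mathbb{R}^2,\|\cdot\|_q)$. Then $(G,p)$ is minimally infinitesimally rigid if and only if $G$ is $(2,2)$-tight.
   Context: Bar-joint framework in a normed linear space $(X,\|\cdot\|)$: a pair $(G,p)$ where $G=(V,E)$ is a finite simple connected graph with vertices $v_1,\dots,v_n$ and $p=(p_1,\dots,p_n)\in X^n$ ($p_i$ is the placement of $v_i$; $p$ is called a realisation of $G$). Infinitesimal flex of $(G,p)$: a vector $u=(u_1,\dots,u_n)\in X^n$ with $\|(p_i+tu_i)-(p_j+tu_j)\|-\|p_i-p_j\|=o(t)$ as $t\to 0$ for every edge $v_iv_j\in E$. Rigid motion of $X$: a family $\{\gamma_x\}_{x\in X}$ of continuous paths $\gamma_x:[-1,1]\to X$, each differentiable at $0$ with $\gamma_x(0)=x$, such that $\|\gamma_x(t)-\gamma_y(t)\|=\|x-y\|$ for all $t\in[-1,1]$, $x,y\in X$. A flex $u$ is trivial if $u=(\gamma_{p_1}'(0),\dots,\gamma_{p_n}'(0))$ for some rigid motion. $(G,p)$ is infinitesimally rigid if every infinitesimal flex is trivial, and infinitesimally flexible otherwise. It is minimally infinitesimally rigid if it is infinitesimally rigid and removing any single edge from $G$ (keeping all vertices and placements) yields an infinitesimally flexible framework (the same definitions are applied to the resulting graph even if it is disconnected). Rigidity matrix: for $a=(a_1,\dots,a_d)\in\mathbb{R}^d$ and $k>0$ write $a^{(k)}=(\operatorname{sgn}(a_1)|a_1|^k,\dots,\operatorname{sgn}(a_d)|a_d|^k)$.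 For $(G,p)$ in $(\mathbb{R}^d,\|\cdot\|_q)$, $R_q(G,p)$ is the $|E|\times nd$ matrix whose row for the edge $v_iv_j$ has $(p_i-p_j)^{(q-1)}$ in the $d$ columns of $p_i$, $-(p_i-p_j)^{(q-1)}$ in the $d$ columns of $p_j$, and zeros elsewhere. $(G,p)$ is regular if $\operatorname{rank} R_q(G,p)$ is maximal over all realisations $p'\in\mathbb{R}^{nd}$ of $G$. A simple connected graph $G=(V,E)$ is $(2,2)$-sparse if $|E(H)|\le 2|V(H)|-2$ for all (nonempty) subgraphs $H=(V(H),E(H))$, and $(2,2)$-tight if in addition $|E|=2|V|-2$. *)

theory Defs
  imports "HOL-Analysis.Analysis" "HOL-Library.Landau_Symbols"
begin

section \<open>Graphs\<close>

text \<open>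
  The vertex set of a graph is the universe of a finite type \<open>'v\<close>, so a graph on
  \<open>n = CARD('v) \<ge> 1\<close> vertices is given by its set of edges, which are two-element sets of vertices.
\<close>

definition simple_graph :: "'v::finite set set \<Rightarrow> bool" where
  "simple_graph E \<longleftrightarrow> (\<forall>e\<in>E. \<exists>i j. i \<noteq> j \<and> e = {i, j})"

definition connected_graph :: "'v::finite set set \<Rightarrow> bool" where
  "connected_graph E \<longleftrightarrow> (\<forall>i j. (i, j) \<in> {(a, b). {a, b} \<in> E}\<^sup>*)"

definition subgraph_of :: "'v::finite set \<Rightarrow> 'v set set \<Rightarrow> 'v set set \<Rightarrow> bool" where
  "subgraph_of W F E \<longleftrightarrow> F \<subseteq> E \<and> (\<forall>e\<in>F. e \<subseteq> W)"

text \<open>The counts are taken in the integers to avoid truncated subtraction.\<close>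

definition sparse22 :: "'v::finite set set \<Rightarrow> bool" where
  "sparse22 E \<longleftrightarrow>
     (\<forall>W F. W \<noteq> {} \<and> subgraph_of W F E \<longrightarrow> int (card F) \<le> 2 * int (card W) - 2)"

definition tight22 :: "'v::finite set set \<Rightarrow> bool" where
  "tight22 E \<longleftrightarrow> sparse22 E \<and> int (card E) = 2 * int CARD('v) - 2"


section \<open>Infinitesimal rigidity in a normed space\<close>

text \<open>
  The norm is an explicit argument \<open>N\<close>, because the type \<^typ>\<open>real ^ 'd\<close> carries only the
  Euclidean one. Continuity and differentiability of paths are accordingly taken with respect
  to \<open>N\<close>.
\<close>

definition has_path_derivative_at_0 ::
    "('x::real_vector \<Rightarrow> real) \<Rightarrow> (real \<Rightarrow> 'x) \<Rightarrow> 'x \<Rightarrow> bool" where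
  "has_path_derivative_at_0 N c v \<longleftrightarrow>
     ((\<lambda>t. N ((c t - c 0) /\<^sub>R t - v)) \<longlongrightarrow> 0) (at 0)"

definition continuous_path :: "('x::real_vector \<Rightarrow> real) \<Rightarrow> (real \<Rightarrow> 'x) \<Rightarrow> bool" where
  "continuous_path N c \<longleftrightarrow>
     (\<forall>t\<in>{-1..1}. ((\<lambda>s. N (c s - c t)) \<longlongrightarrow> 0) (at t within {-1..1}))"

definition rigid_motion ::
    "('x::real_vector \<Rightarrow> real) \<Rightarrow> ('x \<Rightarrow> real \<Rightarrow> 'x) \<Rightarrow> bool" where
  "rigid_motion N \<gamma> \<longleftrightarrow>
     (\<forall>x. continuous_path N (\<gamma> x) \<and> (\<exists>v. has_path_derivative_at_0 N (\<gamma> x) v) \<and> \<gamma> x 0 = x) \<and>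
     (\<forall>t\<in>{-1..1}. \<forall>x y. N (\<gamma> x t - \<gamma> y t) = N (x - y))"

definition infinitesimal_flex ::
    "('x::real_vector \<Rightarrow> real) \<Rightarrow> 'v::finite set set \<Rightarrow> ('v \<Rightarrow> 'x) \<Rightarrow> ('v \<Rightarrow> 'x) \<Rightarrow> bool" where
  "infinitesimal_flex N E p u \<longleftrightarrow>
     (\<forall>i j. {i, j} \<in> E \<longrightarrow>
        (\<lambda>t. N ((p i + t *\<^sub>R u i) - (p j + t *\<^sub>R u j)) - N (p i - p j)) \<in> o[at 0](\<lambda>t. t))"

definition trivial_flex ::
    "('x::real_vector \<Rightarrow> real) \<Rightarrow> ('v::finite \<Rightarrow> 'x) \<Rightarrow> ('v \<Rightarrow> 'x) \<Rightarrow> bool" where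
  "trivial_flex N p u \<longleftrightarrow>
     (\<exists>\<gamma>. rigid_motion N \<gamma> \<and> (\<forall>i. has_path_derivative_at_0 N (\<gamma> (p i)) (u i)))"

definition infinitesimally_rigid ::
    "('x::real_vector \<Rightarrow> real) \<Rightarrow> 'v::finite set set \<Rightarrow> ('v \<Rightarrow> 'x) \<Rightarrow> bool" where
  "infinitesimally_rigid N E p \<longleftrightarrow> (\<forall>u. infinitesimal_flex N E p u \<longrightarrow> trivial_flex N p u)"

definition minimally_infinitesimally_rigid ::
    "('x::real_vector \<Rightarrow> real) \<Rightarrow> 'v::finite set set \<Rightarrow> ('v \<Rightarrow> 'x) \<Rightarrow> bool" where
  "minimally_infinitesimally_rigid N E p \<longleftrightarrow>
     infinitesimally_rigid N E p \<and> (\<forall>e\<in>E. \<not> infinitesimally_rigid N (E - {e}) p)"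


section \<open>The rigidity matrix\<close>

definition lq_norm :: "real \<Rightarrow> real ^ 'd \<Rightarrow> real" where
  "lq_norm q x = (\<Sum>k\<in>UNIV. \<bar>x $ k\<bar> powr q) powr (1 / q)"

definition signed_power :: "real ^ 'd \<Rightarrow> real \<Rightarrow> real ^ 'd" where
  "signed_power a r = (\<chi> k. sgn (a $ k) * \<bar>a $ k\<bar> powr r)"

text \<open>
  Columns are indexed by pairs of a vertex and a coordinate. Rows are indexed by all sets of
  vertices; those which are not edges give zero rows, which do not affect the rank (see
  \<open>rank_rigidity_matrix\<close> below). Since \<open>signed_power\<close> is odd, the block of the edge \<open>{i, j}\<close> at
  either endpoint is the signed power of that endpoint minus the other one, which is independent
  of an orientation of the edge (see \<open>rigidity_matrix_edge\<close>).
\<close>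

definition rigidity_matrix ::
    "real \<Rightarrow> 'v::finite set set \<Rightarrow> ('v \<Rightarrow> real ^ 'd) \<Rightarrow> real ^ ('v \<times> 'd) ^ ('v set)" where
  "rigidity_matrix q E p =
     (\<chi> e c. case c of (v, k) \<Rightarrow>
        if e \<in> E \<and> v \<in> e then signed_power (p v - p (THE w. e = {v, w})) (q - 1) $ k else 0)"

definition regular :: "real \<Rightarrow> 'v::finite set set \<Rightarrow> ('v \<Rightarrow> real ^ 'd) \<Rightarrow> bool" where
  "regular q E p \<longleftrightarrow>
     (\<forall>p' :: 'v \<Rightarrow> real ^ 'd. rank (rigidity_matrix q E p') \<le> rank (rigidity_matrix q E p))"

lemma signed_power_minus: "signed_power (- a) r = - signed_power a r"
  by (simp add: signed_power_def vec_eq_iff sgn_minus)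

lemma rigidity_matrix_edge:
  assumes "i \<noteq> j" "{i, j} \<in> E"
  shows "rigidity_matrix q E p $ {i, j} $ (v, k) =
    (if v = i then signed_power (p i - p j) (q - 1) $ k
     else if v = j then - signed_power (p i - p j) (q - 1) $ k
     else 0)"
proof -
  have "(THE w. {i, j} = {i, w}) = j" "(THE w. {i, j} = {j, w}) = i"
    using assms(1) by (auto intro!: the_equality simp: doubleton_eq_iff)
  moreover have "signed_power (p j - p i) (q - 1) = - signed_power (p i - p j) (q - 1)"
    using signed_power_minus[of "p i - p j"] by simp
  ultimately show ?thesis
    using assms by (simp add: rigidity_matrix_def)
qed

lemma rank_rigidity_matrix:
  "rank (rigidity_matrix q E p) = dim ((\<lambda>e. row e (rigidity_matrix q E p)) ` E)"
proof -
  let ?R = "rigidity_matrix q E p"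
  have 0: "row e ?R = 0" if "e \<notin> E" for e
    using that by (auto simp: row_def rigidity_matrix_def vec_eq_iff)
  have "insert 0 (rows ?R) = insert 0 ((\<lambda>e. row e ?R) ` E)"
    using 0 by (auto simp: rows_def)
  then have "span (rows ?R) = span ((\<lambda>e. row e ?R) ` E)"
    using span_insert_0[of "rows ?R"] span_insert_0[of "(\<lambda>e. row e ?R) ` E"] by argo
  then have "dim (rows ?R) = dim ((\<lambda>e. row e ?R) ` E)"
    by (rule span_eq_dim)
  then show ?thesis
    by (simp add: row_rank_def)
qed

end

theory Submission
  imports Defs "HOL-Complex_Analysis.Complex_Analysis" "HOL-Real_Asymp.Real_Asymp"
begin

text \<open>
  The heart of the matter is that every (2,2)-sparse graph has a placement with independent rows. Place
  the vertices on the parabola, \<open>p i = (x i, (x i)\<^sup>2)\<close> with \<open>x i > 0\<close>: up to scaling, the row of an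
  edge is then \<open>(1, (x i + x j) powr (q - 1))\<close>, which is analytic on a convex domain, so that finitely
  many nondegeneracy conditions can be met simultaneously as soon as each of them can be met. To have
  an induction that is closed under contraction of tight subgraphs, one allows blocks of vertices that
  move by a common translation; two edges joining the same two blocks then still have different
  directions. Contracting tight sets and deleting blocks of degree at most 3 shrinks every such
  graph; reinserting a block of degree 3 is where \<open>q \<noteq> 2\<close> is used.

  Independent rows are supported on differences of velocities, whence the counts \<open>2 |W| - 2\<close>.
  The trivial flexes are the translations, because a velocity field orthogonal to all signed powers of
  differences is constant when \<open>q \<noteq> 2\<close>.
\<close>

section \<open>A vertex joined to three points of the parabola\<close>

text \<open>One independent placement per sparse edge set suffices: \<open>regular\<close> compares
  ranks, so the rank at a regular \<open>p\<close> is at least the size of every sparse subset of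
  \<open>E\<close>. Two obstacles shape the rest. A block of degree 3 imposes three conditions on
  the two components of its velocity, and a motion of the remaining graph has to supply the missing
  parameter. Such a motion is available when an edge between two neighbours can be added without
  losing sparsity; a tight set containing both neighbours would prevent this, hence tight sets are
  contracted beforehand. Contraction creates parallel edges, so the induction is over blocks and not
  over vertices. The other obstacle is that \<open>regular\<close> does not by definition exclude
  edges with \<open>p i = p j\<close>. Their rows vanish, whereas a flex must still satisfy
  \<open>u i = u j\<close>, the norm not being differentiable at 0. Flexes and the kernel of the
  rigidity matrix therefore have to be shown to agree at regular placements.\<close>

lemma powr_second_order:
  fixes a r :: real
  shows "((\<lambda>e. ((1 + a * e) powr r - 1 - r * a * e) / e\<^sup>2) \<longlongrightarrow> r * (r - 1) / 2 * a\<^sup>2) (at_right 0)"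
  by (real_asymp simp: field_simps power2_eq_square)

lemma powr_difference_first_order:
  fixes a b r :: real
  shows "((\<lambda>e. ((1 + b * e) powr r - (1 + a * e) powr r) / e) \<longlongrightarrow> r * (b - a)) (at_right 0)"
  by (real_asymp simp: field_simps power2_eq_square)

text \<open>The hypothesis cancels the first-order terms, so the quotient by \<open>e^2\<close>
  converges and only the second Taylor coefficients remain.\<close>

lemma powr_differences_second_order:
  fixes a b c r F G :: real
  assumes "F * (b - a) = G * (c - a)"
  shows "((\<lambda>e. (F * ((1 + b * e) powr r - (1 + a * e) powr r)
                 - G * ((1 + c * e) powr r - (1 + a * e) powr r)) / e\<^sup>2)
          \<longlongrightarrow> r * (r - 1) / 2 * (F * (b\<^sup>2 - a\<^sup>2) - G * (c\<^sup>2 - a\<^sup>2))) (at_right 0)"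
proof -
  define R where "R t e = ((1 + t * e) powr r - 1 - r * t * e) / e\<^sup>2" for t e :: real
  have R: "(R t \<longlongrightarrow> r * (r - 1) / 2 * t\<^sup>2) (at_right 0)" for t
    unfolding R_def by (rule powr_second_order)
  have P: "(1 + t * e) powr r = 1 + r * t * e + e\<^sup>2 * R t e" if "e > 0" for t e
    using that by (simp add: R_def)
  have lim: "((\<lambda>e. F * (R b e - R a e) - G * (R c e - R a e))
          \<longlongrightarrow> F * (r * (r - 1) / 2 * b\<^sup>2 - r * (r - 1) / 2 * a\<^sup>2)
            - G * (r * (r - 1) / 2 * c\<^sup>2 - r * (r - 1) / 2 * a\<^sup>2)) (at_right 0)"
    by (intro tendsto_intros R)
  have ev: "\<forall>\<^sub>F e in at_right 0. F * (R b e - R a e) - G * (R c e - R a e) =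
      (F * ((1 + b * e) powr r - (1 + a * e) powr r)
                 - G * ((1 + c * e) powr r - (1 + a * e) powr r)) / e\<^sup>2"
  proof (rule eventually_at_rightI[of 0 1])
    fix e :: real assume "e \<in> {0<..<1}"
    then have e: "e > 0" by simp
    have "F * ((1 + b * e) powr r - (1 + a * e) powr r)
                 - G * ((1 + c * e) powr r - (1 + a * e) powr r)
        = r * e * (F * (b - a) - G * (c - a)) + e\<^sup>2 * (F * (R b e - R a e) - G * (R c e - R a e))"
      unfolding P[OF e] by (simp add: algebra_simps)
    then show "F * (R b e - R a e) - G * (R c e - R a e) =
      (F * ((1 + b * e) powr r - (1 + a * e) powr r)
                 - G * ((1 + c * e) powr r - (1 + a * e) powr r)) / e\<^sup>2"
      using assms e by simp
  qed simp
  have "F * (r * (r - 1) / 2 * b\<^sup>2 - r * (r - 1) / 2 * a\<^sup>2) - G * (r * (r - 1) / 2 * c\<^sup>2 - r * (r - 1) / 2 * a\<^sup>2)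
      = r * (r - 1) / 2 * (F * (b\<^sup>2 - a\<^sup>2) - G * (c\<^sup>2 - a\<^sup>2))"
    by (simp only: right_diff_distrib mult_ac)
  with Lim_transform_eventually[OF lim ev] show ?thesis
    by (simp only:)
qed

text \<open>The weights are \<open>1 + O(e)\<close> and multiply differences that are
  \<open>O(e)\<close>. Splitting off the 1 leaves the preceding limit plus products of two
  first-order terms, whence the coefficient \<open>r^2\<close>.\<close>

lemma powr_weighted_differences_second_order:
  fixes a b c r F G :: real
  assumes "F * (b - a) = G * (c - a)"
  shows "((\<lambda>e. (F * (1 + c * e) powr r * ((1 + b * e) powr r - (1 + a * e) powr r)
                 - G * (1 + b * e) powr r * ((1 + c * e) powr r - (1 + a * e) powr r)) / e\<^sup>2)
          \<longlongrightarrow> r * (r - 1) / 2 * (F * (b\<^sup>2 - a\<^sup>2) - G * (c\<^sup>2 - a\<^sup>2))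
              + r\<^sup>2 * (F * (b - a) * c - G * (c - a) * b)) (at_right 0)"
proof -
  define S where "S t e = ((1 + t * e) powr r - 1) / e" for t e :: real
  define T where "T t e = ((1 + t * e) powr r - (1 + a * e) powr r) / e" for t e :: real
  define U where "U e = (F * ((1 + b * e) powr r - (1 + a * e) powr r)
                 - G * ((1 + c * e) powr r - (1 + a * e) powr r)) / e\<^sup>2" for e
  have S: "(S t \<longlongrightarrow> r * t) (at_right 0)" for t
    using powr_difference_first_order[of t r 0] by (simp add: S_def[abs_def])
  have T: "(T t \<longlongrightarrow> r * (t - a)) (at_right 0)" for t
    unfolding T_def by (rule powr_difference_first_order)
  have "(U \<longlongrightarrow> r * (r - 1) / 2 * (F * (b\<^sup>2 - a\<^sup>2) - G * (c\<^sup>2 - a\<^sup>2))) (at_right 0)"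
    unfolding U_def by (rule powr_differences_second_order[OF assms])
  then have lim: "((\<lambda>e. U e + (F * S c e * T b e - G * S b e * T c e)) \<longlongrightarrow>
      r * (r - 1) / 2 * (F * (b\<^sup>2 - a\<^sup>2) - G * (c\<^sup>2 - a\<^sup>2))
      + (F * (r * c) * (r * (b - a)) - G * (r * b) * (r * (c - a)))) (at_right 0)"
    by (intro tendsto_intros S T)
  have ev: "\<forall>\<^sub>F e in at_right 0. U e + (F * S c e * T b e - G * S b e * T c e) =
     (F * (1 + c * e) powr r * ((1 + b * e) powr r - (1 + a * e) powr r)
                 - G * (1 + b * e) powr r * ((1 + c * e) powr r - (1 + a * e) powr r)) / e\<^sup>2"
    by (rule eventually_at_rightI[of 0 1])
       (auto simp: U_def S_def T_def field_simps power2_eq_square)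
  have "F * (r * c) * (r * (b - a)) - G * (r * b) * (r * (c - a))
      = r\<^sup>2 * (F * (b - a) * c - G * (c - a) * b)"
    by (simp add: algebra_simps power2_eq_square)
  with Lim_transform_eventually[OF lim ev] show ?thesis
    by (simp only:)
qed

lemma proportional_eq_0:
  fixes F G B C k :: real
  assumes "F * B = G * C" "F * B * k = G * C * l" "k \<noteq> l" "B \<noteq> 0" "C \<noteq> 0"
  shows "F = 0 \<and> G = 0"
proof -
  have "F * B * (k - l) = 0" using assms(1,2) by (simp add: algebra_simps)
  then show ?thesis using assms by auto
qed

text \<open>The inequality says that a nontrivial motion of three points on the parabola does not extend to a
  fourth point at \<open>z\<close> joined to all three. With \<open>z = 1/e\<close>, its failure for all \<open>z\<close> becomes
  \<open>e powr r * P e + Q e = 0\<close>, and the expansions of \<open>P\<close> and \<open>Q\<close> to second order at \<open>e = 0\<close> force all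
  coefficients to vanish. For \<open>r = 1\<close> the statement is false because of rotations.\<close>

lemma exists_noncollapsing_shift:
  fixes a b c r :: real and f1 f2 f3 g1 g2 g3 :: real
  assumes abc: "a > 0" "b > 0" "c > 0" "a \<noteq> b" "b \<noteq> c" "a \<noteq> c" and r: "r > 0" "r \<noteq> 1"
    and nontriv: "\<not> (f1 = f2 \<and> f2 = f3 \<and> g1 = g2 \<and> g2 = g3)"
  shows "\<exists>z>0. ((z + b) powr r - (z + a) powr r) *
        ((f3 + (z + c) powr r * g3) - (f1 + (z + a) powr r * g1)) \<noteq>
      ((z + c) powr r - (z + a) powr r) *
        ((f2 + (z + b) powr r * g2) - (f1 + (z + a) powr r * g1))"
proof (rule ccontr)
  assume "\<not> ?thesis"
  then have *: "((z + b) powr r - (z + a) powr r) *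
        ((f3 + (z + c) powr r * g3) - (f1 + (z + a) powr r * g1)) =
      ((z + c) powr r - (z + a) powr r) *
        ((f2 + (z + b) powr r * g2) - (f1 + (z + a) powr r * g1))" if "z > 0" for z
    using that by blast
  define F G H K where "F = f3 - f1" and "G = f2 - f1" and "H = g3 - g1" and "K = g2 - g1"
  define \<phi> where "\<phi> t e = (1 + t * e) powr r" for t e :: real
  define P where "P e = F * (\<phi> b e - \<phi> a e) - G * (\<phi> c e - \<phi> a e)" for e
  define Q where "Q e = H * \<phi> c e * (\<phi> b e - \<phi> a e) - K * \<phi> b e * (\<phi> c e - \<phi> a e)" for e
  \<comment> \<open>Since \<open>(1/e + t) powr r\<close> is \<open>\<phi> t e / e powr r\<close>,
    multiplying the identity at \<open>z = 1/e\<close> by \<open>e powr (2 * r)\<close> clears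
    denominators. The terms in \<open>F\<close> and \<open>G\<close> contain one power fewer and so
    keep a factor \<open>e powr r\<close>.\<close>
  have PQ: "e powr r * P e + Q e = 0" if e: "e > 0" for e
  proof -
    define A B C where "A = (1/e + a) powr r" and "B = (1/e + b) powr r" and "C = (1/e + c) powr r"
    have conv: "\<phi> t e = e powr r * (1/e + t) powr r" if "t > 0" for t
    proof -
      have "1 + t * e = e * (1/e + t)" using e by (simp add: field_simps)
      then show ?thesis unfolding \<phi>_def using e that by (simp add: powr_mult)
    qed
    have "(B - A) * ((f3 + C * g3) - (f1 + A * g1)) = (C - A) * ((f2 + B * g2) - (f1 + A * g1))"
      using *[of "1/e"] e by (simp add: A_def B_def C_def)
    then have "F * (B - A) - G * (C - A) + H * C * (B - A) - K * B * (C - A) = 0"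
      unfolding F_def G_def H_def K_def by (simp add: algebra_simps)
    moreover have "e powr r * P e + Q e
        = e powr r * e powr r * (F * (B - A) - G * (C - A) + H * C * (B - A) - K * B * (C - A))"
      unfolding P_def Q_def conv[OF abc(1)] conv[OF abc(2)] conv[OF abc(3)] A_def B_def C_def
      by (simp add: algebra_simps)
    ultimately show ?thesis by simp
  qed
  have phi1: "(\<phi> t \<longlongrightarrow> 1) (at_right 0)" for t
    unfolding \<phi>_def by real_asymp
  have d1: "((\<lambda>e. (\<phi> t e - \<phi> a e) / e) \<longlongrightarrow> r * (t - a)) (at_right 0)" for t
    unfolding \<phi>_def by (rule powr_difference_first_order)
  have "((\<lambda>e. F * ((\<phi> b e - \<phi> a e) / e) - G * ((\<phi> c e - \<phi> a e) / e)) \<longlongrightarrow>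
      F * (r * (b - a)) - G * (r * (c - a))) (at_right 0)"
    by (intro tendsto_intros d1)
  then have P1: "((\<lambda>e. P e / e) \<longlongrightarrow> r * (F * (b - a) - G * (c - a))) (at_right 0)"
    by (simp add: P_def diff_divide_distrib add_divide_distrib algebra_simps)
  have "((\<lambda>e. H * \<phi> c e * ((\<phi> b e - \<phi> a e) / e) - K * \<phi> b e * ((\<phi> c e - \<phi> a e) / e)) \<longlongrightarrow>
      H * 1 * (r * (b - a)) - K * 1 * (r * (c - a))) (at_right 0)"
    by (intro tendsto_intros d1 phi1)
  then have Q1: "((\<lambda>e. Q e / e) \<longlongrightarrow> r * (H * (b - a) - K * (c - a))) (at_right 0)"
    by (simp add: Q_def diff_divide_distrib add_divide_distrib algebra_simps)
  have pos: "\<forall>\<^sub>F e::real in at_right 0. e > 0"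
    by (simp add: eventually_at_right_less)
  have er: "((\<lambda>e. e powr s) \<longlongrightarrow> 0) (at_right 0)" if "s > 0" for s :: real
    using that by real_asymp
  have "((\<lambda>e. e powr r * (P e / e)) \<longlongrightarrow> 0 * (r * (F * (b - a) - G * (c - a)))) (at_right 0)"
    by (intro tendsto_mult er P1 r)
  moreover have "\<forall>\<^sub>F e in at_right 0. e powr r * (P e / e) = - (Q e / e)"
    using pos
  proof eventually_elim
    case (elim e) then show ?case using PQ[OF elim] by (simp add: field_simps)
  qed
  ultimately have "((\<lambda>e. - (Q e / e)) \<longlongrightarrow> 0) (at_right 0)"
    by (simp add: tendsto_cong)
  then have "((\<lambda>e. Q e / e) \<longlongrightarrow> 0) (at_right 0)"
    using tendsto_minus by force
  then have q1: "H * (b - a) = K * (c - a)"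
    using tendsto_unique[OF _ Q1] r by force
  have Q2: "((\<lambda>e. Q e / e\<^sup>2) \<longlongrightarrow> r * (r - 1) / 2 * (H * (b\<^sup>2 - a\<^sup>2) - K * (c\<^sup>2 - a\<^sup>2))
              + r\<^sup>2 * (H * (b - a) * c - K * (c - a) * b)) (at_right 0)"
    unfolding Q_def \<phi>_def by (rule powr_weighted_differences_second_order[OF q1])
  have P2: "((\<lambda>e. P e / e\<^sup>2) \<longlongrightarrow> r * (r - 1) / 2 * (F * (b\<^sup>2 - a\<^sup>2) - G * (c\<^sup>2 - a\<^sup>2))) (at_right 0)"
    if "F * (b - a) = G * (c - a)"
    unfolding P_def \<phi>_def by (rule powr_differences_second_order[OF that])
  have "((\<lambda>e. Q e / e\<^sup>2) \<longlongrightarrow> 0) (at_right 0)"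
  proof (cases "r > 1")
    case True
    then have "((\<lambda>e. e powr (r - 1) * (P e / e)) \<longlongrightarrow> 0 * (r * (F * (b - a) - G * (c - a)))) (at_right 0)"
      by (intro tendsto_mult er P1) simp
    moreover have "\<forall>\<^sub>F e in at_right 0. e powr (r - 1) * (P e / e) = - (Q e / e\<^sup>2)"
      using pos
    proof eventually_elim
      case (elim e) then show ?case using PQ[OF elim]
        by (simp add: field_simps powr_diff power2_eq_square)
    qed
    ultimately have "((\<lambda>e. - (Q e / e\<^sup>2)) \<longlongrightarrow> 0) (at_right 0)"
      by (simp add: tendsto_cong)
    then show ?thesis
      using tendsto_minus by force
  next
    \<comment> \<open>For \<open>r < 1\<close> the factor \<open>e powr (r - 1)\<close> is of no
      use, so the comparison is reversed first: \<open>Q\<close> is already of second order, which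
      forces the first-order coefficient of \<open>P\<close> to vanish. Then
      \<open>P e / e^2\<close> is bounded near 0 and \<open>e powr r\<close> takes it to 0.\<close>
    case False
    then have "((\<lambda>e. e powr (1 - r) * (Q e / e\<^sup>2)) \<longlongrightarrow> 0 * (r * (r - 1) / 2 * (H * (b\<^sup>2 - a\<^sup>2) - K * (c\<^sup>2 - a\<^sup>2))
              + r\<^sup>2 * (H * (b - a) * c - K * (c - a) * b))) (at_right 0)"
      using r by (intro tendsto_mult er Q2) simp
    moreover have "\<forall>\<^sub>F e in at_right 0. e powr (1 - r) * (Q e / e\<^sup>2) = - (P e / e)"
      using pos
    proof eventually_elim
      case (elim e) then show ?case using PQ[OF elim]
        by (simp add: field_simps powr_diff power2_eq_square)
    qed
    ultimately have "((\<lambda>e. - (P e / e)) \<longlongrightarrow> 0) (at_right 0)"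
      by (simp add: tendsto_cong)
    then have "((\<lambda>e. P e / e) \<longlongrightarrow> 0) (at_right 0)"
      using tendsto_minus by force
    then have p1: "F * (b - a) = G * (c - a)"
      using tendsto_unique[OF _ P1] r by force
    have "((\<lambda>e. e powr r * (P e / e\<^sup>2)) \<longlongrightarrow> 0 * (r * (r - 1) / 2 * (F * (b\<^sup>2 - a\<^sup>2) - G * (c\<^sup>2 - a\<^sup>2)))) (at_right 0)"
      by (intro tendsto_mult er P2 p1 r)
    moreover have "\<forall>\<^sub>F e in at_right 0. e powr r * (P e / e\<^sup>2) = - (Q e / e\<^sup>2)"
      using pos
    proof eventually_elim
      case (elim e) then show ?case using PQ[OF elim] by (simp add: field_simps)
    qed
    ultimately have "((\<lambda>e. - (Q e / e\<^sup>2)) \<longlongrightarrow> 0) (at_right 0)"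
      by (simp add: tendsto_cong)
    then show ?thesis
      using tendsto_minus by force
  qed
  then have "r * (r - 1) / 2 * (H * (b\<^sup>2 - a\<^sup>2) - K * (c\<^sup>2 - a\<^sup>2))
              + r\<^sup>2 * (H * (b - a) * c - K * (c - a) * b) = 0"
    using tendsto_unique[OF _ Q2] by force
  moreover have "r * (r - 1) / 2 * (H * (b\<^sup>2 - a\<^sup>2) - K * (c\<^sup>2 - a\<^sup>2))
              + r\<^sup>2 * (H * (b - a) * c - K * (c - a) * b)
      = H * (b - a) * (r * (r - 1) / 2 * (b + a) + r\<^sup>2 * c)
        - K * (c - a) * (r * (r - 1) / 2 * (c + a) + r\<^sup>2 * b)"
  proof -
    have "k * (H * (b\<^sup>2 - a\<^sup>2) - K * (c\<^sup>2 - a\<^sup>2)) + l * (H * (b - a) * c - K * (c - a) * b)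
        = H * (b - a) * (k * (b + a) + l * c) - K * (c - a) * (k * (c + a) + l * b)" for k l
      by (simp add: algebra_simps power2_eq_square)
    then show ?thesis by blast
  qed
  \<comment> \<open>The two sides differ by \<open>r * (r + 1) / 2 * (c - b)\<close>, so the two
    relations between \<open>H\<close> and \<open>K\<close> are independent.\<close>
  moreover have "r * (r - 1) / 2 * (b + a) + r\<^sup>2 * c \<noteq> r * (r - 1) / 2 * (c + a) + r\<^sup>2 * b"
  proof
    assume "r * (r - 1) / 2 * (b + a) + r\<^sup>2 * c = r * (r - 1) / 2 * (c + a) + r\<^sup>2 * b"
    then have "r * (r + 1) * (c - b) = 0" by (simp add: field_simps power2_eq_square)
    then show False using r abc by auto
  qed
  ultimately have HK: "H = 0 \<and> K = 0"
    using proportional_eq_0[OF q1] abc by simp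
  then have P0: "P e = 0" if "e > 0" for e
    using PQ[OF that] that by (simp add: Q_def)
  have ev0: "\<forall>\<^sub>F e in at_right 0. P e / e = 0" "\<forall>\<^sub>F e in at_right 0. P e / e\<^sup>2 = 0"
    using pos by (auto elim!: eventually_mono simp: P0)
  have "((\<lambda>e. P e / e) \<longlongrightarrow> 0) (at_right 0)" "((\<lambda>e. P e / e\<^sup>2) \<longlongrightarrow> 0) (at_right 0)"
    using ev0 by (auto intro: tendsto_eventually)
  then have p1: "F * (b - a) = G * (c - a)"
    and "r * (r - 1) / 2 * (F * (b\<^sup>2 - a\<^sup>2) - G * (c\<^sup>2 - a\<^sup>2)) = 0"
    using tendsto_unique[OF _ P1] tendsto_unique[OF _ P2] r by force+
  \<comment> \<open>Here \<open>r - 1\<close> is cancelled. At \<open>r = 1\<close> the function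
    \<open>P\<close> would be linear in \<open>e\<close> and its second-order coefficient would give
    no relation.\<close>
  then have "F * (b\<^sup>2 - a\<^sup>2) = G * (c\<^sup>2 - a\<^sup>2)" using r by simp
  then have "F * (b - a) * (b + a) = G * (c - a) * (c + a)"
    by (simp add: algebra_simps power2_eq_square)
  then have "F = 0 \<and> G = 0"
    using proportional_eq_0[OF p1] abc by simp
  then show False
    using HK nontriv by (simp add: F_def G_def H_def K_def)
qed

section \<open>Generic points on the parabola\<close>

text \<open>The second clause replaces the density of \<open>P\<close> and is what makes \<open>generic\<close> stable under
  conjunction: on any segment issuing from a point of \<open>P\<close>, only finitely many points fail.\<close>

definition generic :: "(('v \<Rightarrow> real) \<Rightarrow> bool) \<Rightarrow> bool" where
  "generic P \<longleftrightarrow> (\<exists>x. (\<forall>i. 0 < x i) \<and> P x) \<and>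
     (\<forall>x y. (\<forall>i. 0 < x i) \<and> (\<forall>i. 0 < y i) \<and> P x \<longrightarrow>
        finite {t\<in>{0..1}. \<not> P (\<lambda>i. x i + t * (y i - x i))})"

lemma generic_witness: "generic P \<Longrightarrow> \<exists>x. (\<forall>i. 0 < x i) \<and> P x"
  by (simp add: generic_def)

lemma generic_finite:
  assumes "generic P" "\<forall>i. 0 < x i" "\<forall>i. 0 < y i" "P x"
  shows "finite {t\<in>{0..1}. \<not> P (\<lambda>i. x i + t * (y i - x i))}"
  using assms by (auto simp: generic_def)

lemma segment_pos:
  fixes x y t :: real
  assumes "0 < x" "0 < y" "t \<in> {0..1}"
  shows "0 < x + t * (y - x)"
proof -
  have "x + t * (y - x) = (1 - t) * x + t * y" by (simp add: algebra_simps)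
  moreover have "0 < (1 - t) * x + t * y"
    using assms by (cases "t = 1") (auto intro!: add_pos_nonneg)
  ultimately show ?thesis by simp
qed

text \<open>A witness of \<open>P\<close> and a witness of \<open>Q\<close> are joined by a segment,
  read forwards for \<open>P\<close> and backwards for \<open>Q\<close>. Each property fails at
  finitely many parameters only, so some parameter serves both.\<close>

lemma generic_conj:
  assumes P: "generic P" and Q: "generic Q"
  shows "generic (\<lambda>x. P x \<and> Q x)"
  unfolding generic_def
proof (intro conjI allI impI)
  obtain x where x: "\<forall>i. 0 < x i" "P x" using generic_witness[OF P] by (elim exE conjE)
  obtain y where y: "\<forall>i. 0 < y i" "Q y" using generic_witness[OF Q] by (elim exE conjE)
  let ?A = "{t\<in>{0..1}. \<not> P (\<lambda>i. x i + t * (y i - x i))}"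
  let ?B = "(\<lambda>t. 1 - t) ` {t\<in>{0..1}. \<not> Q (\<lambda>i. y i + t * (x i - y i))}"
  have A: "finite ?A" using generic_finite[OF P] x y by simp
  have B: "finite ?B" using generic_finite[OF Q] x y by (intro finite_imageI) simp
  have "infinite ({0..1::real} - (?A \<union> ?B))"
    by (intro Diff_infinite_finite finite_UnI A B infinite_Icc) simp
  then have "{0..1::real} - (?A \<union> ?B) \<noteq> {}"
    by (metis finite.emptyI)
  then obtain t where t: "t \<in> {0..1}" "t \<notin> ?A \<union> ?B"
    by (auto simp only: ex_in_conv[symmetric] Diff_iff)
  have "Q (\<lambda>i. x i + t * (y i - x i))"
  proof (rule ccontr)
    assume "\<not> ?thesis"
    moreover have "(\<lambda>i. x i + t * (y i - x i)) = (\<lambda>i. y i + (1 - t) * (x i - y i))"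
      by (auto simp: algebra_simps)
    ultimately have "1 - (1 - t) \<in> ?B" using t(1) by (intro imageI) auto
    then show False using t by simp
  qed
  then show "\<exists>x. (\<forall>i. 0 < x i) \<and> P x \<and> Q x"
    using t x(1) y(1) by (intro exI[of _ "\<lambda>i. x i + t * (y i - x i)"]) (auto intro!: segment_pos)
next
  fix x y :: "'a \<Rightarrow> real"
  assume *: "(\<forall>i. 0 < x i) \<and> (\<forall>i. 0 < y i) \<and> P x \<and> Q x"
  have "{t\<in>{0..1}. \<not> (P (\<lambda>i. x i + t * (y i - x i)) \<and> Q (\<lambda>i. x i + t * (y i - x i)))}
      = {t\<in>{0..1}. \<not> P (\<lambda>i. x i + t * (y i - x i))} \<union> {t\<in>{0..1}. \<not> Q (\<lambda>i. x i + t * (y i - x i))}"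
    by auto
  then show "finite {t\<in>{0..1}. \<not> (P (\<lambda>i. x i + t * (y i - x i)) \<and> Q (\<lambda>i. x i + t * (y i - x i)))}"
    using * generic_finite[OF P] generic_finite[OF Q] by simp
qed

text \<open>Different pairs of vertices get chords of different slopes; the case
  \<open>a = b\<close>, \<open>c = d\<close> is injectivity of \<open>x\<close>. Powers of 3 are a
  witness, because two of them add without carry in base 3 and the sum determines the
  summands.\<close>

lemma generic_sum_inj:
  "generic (\<lambda>x::'v::finite \<Rightarrow> real. \<forall>a b c d. x a + x b = x c + x d \<longrightarrow> {a, b} = {c, d})"
  unfolding generic_def
proof (intro conjI allI impI)
  obtain h :: "'v \<Rightarrow> nat" where h: "inj h"
    using finite_imp_inj_to_nat_seg[of "UNIV :: 'v set"] by auto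
  let ?x = "\<lambda>i. (3::real) ^ h i"
  have main: "{a, b} = {c, d}" if "?x a + ?x b = ?x c + ?x d" for a b c d
  proof -
    have "real (3 ^ h a + 3 ^ h b) = real (3 ^ h c + 3 ^ h d)"
      using that by simp
    then have eq: "(3::nat) ^ h a + 3 ^ h b = 3 ^ h c + 3 ^ h d"
      by (simp only: of_nat_eq_iff)
    have key: "m = k \<and> n = l" if "(3::nat) ^ m + 3 ^ n = 3 ^ k + 3 ^ l" "m \<le> n" "k \<le> l" for m n k l
    proof -
      have less: False if "(3::nat) ^ m + 3 ^ n = 3 ^ k + 3 ^ l" "m \<le> n" "k \<le> l" "n < l" for m n k l
      proof -
        have "(3::nat) ^ n \<ge> 3 ^ m" using that by simp
        moreover have "(3::nat) ^ l \<ge> 3 ^ Suc n" using that by (intro power_increasing) auto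
        moreover have "(3::nat) ^ n > 0" "(3::nat) ^ k > 0" by auto
        ultimately show False using that(1) unfolding power_Suc by linarith
      qed
      have "n = l" using less[OF that] less[OF that(1)[symmetric] that(3,2)] by (meson nat_neq_iff)
      then show ?thesis using that by simp
    qed
    have eqs: "(3::nat) ^ h b + 3 ^ h a = 3 ^ h c + 3 ^ h d"
      "(3::nat) ^ h a + 3 ^ h b = 3 ^ h d + 3 ^ h c" "(3::nat) ^ h b + 3 ^ h a = 3 ^ h d + 3 ^ h c"
      using eq by linarith+
    consider "h a \<le> h b" "h c \<le> h d" | "h b \<le> h a" "h c \<le> h d"
      | "h a \<le> h b" "h d \<le> h c" | "h b \<le> h a" "h d \<le> h c"
      by linarith
    then have "{h a, h b} = {h c, h d}"
      by cases (use key[OF eq] key[OF eqs(1)] key[OF eqs(2)] key[OF eqs(3)] in auto)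
    then have "h ` {a, b} = h ` {c, d}" by simp
    then show ?thesis using inj_image_eq_iff[OF h] by (simp only:)
  qed
  show "\<exists>x::'v \<Rightarrow> real. (\<forall>i. 0 < x i) \<and> (\<forall>a b c d. x a + x b = x c + x d \<longrightarrow> {a, b} = {c, d})"
    by (intro exI[of _ ?x] conjI allI impI main) simp_all
next
  fix x y :: "'v \<Rightarrow> real"
  assume *: "(\<forall>i. 0 < x i) \<and> (\<forall>i. 0 < y i) \<and> (\<forall>a b c d. x a + x b = x c + x d \<longrightarrow> {a, b} = {c, d})"
  let ?s = "\<lambda>t i. x i + t * (y i - x i)"
  \<comment> \<open>The only root of an affine function of \<open>t\<close> that is nonzero at
    \<open>t = 0\<close>. If the denominator vanishes there is no root, and the default value 0
    merely enlarges a finite set.\<close>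
  let ?f = "\<lambda>(a, b, c, d). (x a + x b - x c - x d) / ((y c - x c) + (y d - x d) - (y a - x a) - (y b - x b))"
  have "t \<in> range ?f" if "?s t a + ?s t b = ?s t c + ?s t d" "{a, b} \<noteq> {c, d}" for t a b c d
  proof -
    have "x a + x b \<noteq> x c + x d"
      using *[THEN conjunct2, THEN conjunct2, rule_format, of a b c d] that(2) by blast
    then have ne: "x a + x b - x c - x d \<noteq> 0" by linarith
    moreover have e: "t * ((y c - x c) + (y d - x d) - (y a - x a) - (y b - x b)) = x a + x b - x c - x d"
      using that(1) by (simp add: algebra_simps)
    ultimately have "t = ?f (a, b, c, d)" by (auto simp: eq_divide_eq)
    then show ?thesis by blast
  qed
  then have "{t\<in>{0..1}. \<not> (\<forall>a b c d. ?s t a + ?s t b = ?s t c + ?s t d \<longrightarrow> {a, b} = {c, d})} \<subseteq> range ?f"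
    by blast
  then show "finite {t\<in>{0..1}. \<not> (\<forall>a b c d. ?s t a + ?s t b = ?s t c + ?s t d \<longrightarrow> {a, b} = {c, d})}"
    by (rule finite_subset) simp
qed

text \<open>For \<open>p i = (x i, (x i)\<^sup>2)\<close> the chord from \<open>p i\<close> to \<open>p j\<close> has slope \<open>x i + x j\<close>, so up to the
  factor \<open>sgn (x i - x j) * \<bar>x i - x j\<bar> powr r\<close> with \<open>r = q - 1\<close> the value below is the row of the edge
  applied to the velocities \<open>(f, g)\<close>. Vertices in the same block, i.e. with equal \<open>\<pi>\<close>, have equal velocities.
  Solvability for all right-hand sides expresses linear independence of the rows.\<close>

definition edge_value ::
    "real \<Rightarrow> ('v \<Rightarrow> real) \<Rightarrow> ('v \<Rightarrow> 'b) \<Rightarrow> ('b \<Rightarrow> real) \<Rightarrow> ('b \<Rightarrow> real) \<Rightarrow> 'v \<times> 'v \<Rightarrow> real" where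
  "edge_value r x \<pi> f g e =
     f (\<pi> (fst e)) - f (\<pi> (snd e)) + (x (fst e) + x (snd e)) powr r * (g (\<pi> (fst e)) - g (\<pi> (snd e)))"

definition solvable ::
    "real \<Rightarrow> ('v \<times> 'v) set \<Rightarrow> ('v \<Rightarrow> 'b) \<Rightarrow> ('v \<Rightarrow> real) \<Rightarrow> bool" where
  "solvable r F \<pi> x \<longleftrightarrow> (\<forall>\<tau>. \<exists>f g. \<forall>e\<in>F. edge_value r x \<pi> f g e = \<tau> e)"

section \<open>Solvability as a nonvanishing analytic condition\<close>

lemma solvable_mono: "solvable r F \<pi> x \<Longrightarrow> G \<subseteq> F \<Longrightarrow> solvable r G \<pi> x"
  unfolding solvable_def by blast

lemma edge_value_sum:
  "edge_value r x \<pi> (\<lambda>b. \<Sum>k\<in>K. c k * f k b) (\<lambda>b. \<Sum>k\<in>K. c k * g k b) e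
     = (\<Sum>k\<in>K. c k * edge_value r x \<pi> (f k) (g k) e)"
  by (simp add: edge_value_def sum_subtractf sum.distrib sum_distrib_left algebra_simps)

text \<open>Solutions are sought as combinations of fixed fields \<open>(f k, g k)\<close>, one for
  each edge in \<open>F\<close>. The determinant is indexed by all pairs of vertices, so the matrix
  is padded with the identity outside \<open>F\<close>.\<close>

lemma solvable_if_det_nonzero:
  fixes F :: "('v::finite \<times> 'v) set"
  assumes "det (\<chi> e k. if e \<in> F \<and> k \<in> F then edge_value r x \<pi> (f k) (g k) e
                        else if e = k then 1 else 0 :: real^('v\<times>'v)^('v\<times>'v)) \<noteq> 0"
  shows "solvable r F \<pi> x"
  unfolding solvable_def
proof
  fix \<tau> :: "'v \<times> 'v \<Rightarrow> real"
  define M :: "real^('v\<times>'v)^('v\<times>'v)" where "M = (\<chi> e k. if e \<in> F \<and> k \<in> F then edge_value r x \<pi> (f k) (g k) e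
                        else if e = k then 1 else 0)"
  have "invertible M" using assms by (simp add: M_def invertible_det_nz)
  then obtain M' where M': "M ** M' = mat 1" by (auto simp: invertible_def)
  define c where "c = M' *v (\<chi> e. \<tau> e)"
  have Mc: "M *v c = (\<chi> e. \<tau> e)" unfolding c_def by (simp add: matrix_vector_mul_assoc M')
  have "edge_value r x \<pi> (\<lambda>b. \<Sum>k\<in>F. c $ k * f k b) (\<lambda>b. \<Sum>k\<in>F. c $ k * g k b) e = \<tau> e" if "e \<in> F" for e
  proof -
    have "\<tau> e = (\<Sum>k\<in>UNIV. M $ e $ k * c $ k)"
      using arg_cong[OF Mc, of "\<lambda>v. v $ e"] by (simp add: matrix_vector_mult_def)
    also have "\<dots> = (\<Sum>k\<in>F. M $ e $ k * c $ k)"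
      using that by (intro sum.mono_neutral_right) (auto simp: M_def)
    also have "\<dots> = (\<Sum>k\<in>F. c $ k * edge_value r x \<pi> (f k) (g k) e)"
      using that by (intro sum.cong) (auto simp: M_def)
    finally show ?thesis by (simp add: edge_value_sum)
  qed
  then show "\<exists>f g. \<forall>e\<in>F. edge_value r x \<pi> f g e = \<tau> e" by blast
qed

text \<open>Solutions at \<open>x\<close> for unit right-hand sides make the matrix \<open>M t\<close> of the system the identity at
  \<open>t = 0\<close>; its determinant extends holomorphically to a neighbourhood of the segment, hence has finitely
  many zeros there.\<close>

lemma solvable_generic:
  fixes F :: "('v::finite \<times> 'v) set"
  assumes "\<And>i. 0 < x0 i" "solvable r F \<pi> x0"
  shows "generic (solvable r F \<pi>)"
  unfolding generic_def
proof (intro conjI allI impI)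
  show "\<exists>x. (\<forall>i. 0 < x i) \<and> solvable r F \<pi> x" using assms by blast
next
  fix x y :: "'v \<Rightarrow> real"
  assume *: "(\<forall>i. 0 < x i) \<and> (\<forall>i. 0 < y i) \<and> solvable r F \<pi> x"
  have "\<forall>k. \<exists>fg. \<forall>e\<in>F. edge_value r x \<pi> (fst fg) (snd fg) e = (if e = k then 1 else 0)"
    using * by (simp add: solvable_def)
  then obtain fg where fg: "\<And>k e. e \<in> F \<Longrightarrow> edge_value r x \<pi> (fst (fg k)) (snd (fg k)) e = (if e = k then 1 else 0)"
    by metis
  define s where "s t i = x i + t * (y i - x i)" for t i
  define M :: "real \<Rightarrow> real^('v\<times>'v)^('v\<times>'v)" where
    "M t = (\<chi> e k. if e \<in> F \<and> k \<in> F then edge_value r (s t) \<pi> (fst (fg k)) (snd (fg k)) e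
                        else if e = k then 1 else 0)" for t
  define L where "L z e = of_real (x (fst e) + x (snd e)) + z * of_real (y (fst e) - x (fst e) + (y (snd e) - x (snd e)))"
    for z :: complex and e :: "'v \<times> 'v"
  define C :: "complex \<Rightarrow> complex^('v\<times>'v)^('v\<times>'v)" where
    "C z = (\<chi> e k. if e \<in> F \<and> k \<in> F then
          of_real (fst (fg k) (\<pi> (fst e)) - fst (fg k) (\<pi> (snd e)))
          + L z e powr of_real r * of_real (snd (fg k) (\<pi> (fst e)) - snd (fg k) (\<pi> (snd e)))
        else if e = k then 1 else 0)" for z
  \<comment> \<open>On \<open>S\<close> all sums of abscissae have positive real part and thus avoid
    the cut of the principal branch of \<open>powr\<close>. As an intersection of half-planes,
    \<open>S\<close> is convex, hence connected, which the identity theorem needs.\<close>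
  define S where "S = (\<Inter>e. {z. 0 < Re (L z e)})"
  have LS: "L z e \<notin> \<real>\<^sub>\<le>\<^sub>0" if "z \<in> S" for z e
  proof -
    have "0 < Re (L z e)" using that unfolding S_def by blast
    then show ?thesis by (simp add: complex_nonpos_Reals_iff)
  qed
  have "open S"
    unfolding S_def L_def
    by (intro open_INT finite ballI open_Collect_less continuous_intros)
  have "convex S"
    unfolding S_def
  proof (intro convex_INT)
    fix e :: "'v \<times> 'v"
    have "{z. 0 < Re (L z e)} = {z. - (y (fst e) - x (fst e) + (y (snd e) - x (snd e))) * Re z < x (fst e) + x (snd e)}"
      by (auto simp: L_def algebra_simps)
    also have "\<dots> = {z. inner (complex_of_real (- (y (fst e) - x (fst e) + (y (snd e) - x (snd e))))) z < x (fst e) + x (snd e)}"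
      by (simp add: inner_complex_def)
    finally show "convex {z. 0 < Re (L z e)}" by (simp only: convex_halfspace_lt)
  qed
  have Lreal: "L (of_real t) e = of_real (s t (fst e) + s t (snd e))" for t e
    by (simp add: L_def s_def algebra_simps)
  have spos: "0 < s t i" if "t \<in> {0..1}" for t i
    unfolding s_def using * that by (intro segment_pos) auto
  have det: "det (C (of_real t)) = of_real (det (M t))" if "t \<in> {0..1}" for t
  proof -
    have "C (of_real t) $ e $ k = of_real (M t $ e $ k)" for e k
      unfolding C_def M_def edge_value_def using spos[OF that, of "fst e"] spos[OF that, of "snd e"]
      by (auto simp: Lreal powr_of_real simp del: of_real_add) (simp_all add: algebra_simps)
    then show ?thesis by (simp add: det_def)
  qed
  have KS: "of_real ` {0..1} \<subseteq> S"
  proof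
    fix z assume "z \<in> complex_of_real ` {0..1}"
    then obtain t where t: "z = of_real t" "t \<in> {0..1}" by blast
    then show "z \<in> S"
      unfolding S_def using spos[OF t(2)] by (simp add: Lreal add_pos_pos del: of_real_add)
  qed
  have hol: "(\<lambda>z. det (C z)) holomorphic_on S"
  proof -
    have hL: "(\<lambda>z. L z e) holomorphic_on S" for e
      unfolding L_def by (intro holomorphic_intros)
    have "(\<lambda>z. L z e powr of_real r * of_real u) holomorphic_on S" for e u
      by (intro holomorphic_intros hL LS)
    then have "(\<lambda>z. C z $ e $ k) holomorphic_on S" for e k
      unfolding C_def by (cases "e \<in> F \<and> k \<in> F") (auto intro!: holomorphic_intros hL LS simp del: of_real_diff)
    then show ?thesis unfolding det_def by (intro holomorphic_intros)
  qed
  have M0: "det (M 0) = 1"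
  proof -
    have "s 0 = x" by (simp add: s_def[abs_def])
    then have "M 0 = mat 1" by (auto simp: M_def vec_eq_iff mat_def fg)
    then show ?thesis by simp
  qed
  \<comment> \<open>The determinant is 1 at 0, so if it is constant it has no zero; otherwise the
    identity theorem leaves finitely many zeros on the compact segment.\<close>
  have zeros: "finite {z \<in> of_real ` {0..1}. det (C z) = 0}"
  proof (cases "(\<lambda>z. det (C z)) constant_on S")
    case True
    then obtain c where c: "\<And>z. z \<in> S \<Longrightarrow> det (C z) = c"
      unfolding constant_on_def by blast
    have "of_real 0 \<in> S" using KS by (rule subsetD) (intro imageI, simp)
    then have "c = 1" using c det[of 0] M0 by simp
    then have "det (C z) = 1" if "z \<in> S" for z
      using c[OF that] by simp
    then have "{z \<in> of_real ` {0..1}. det (C z) = 0} = {}" using KS by (metis (mono_tags, lifting) empty_Collect_eq subsetD zero_neq_one)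
    then show ?thesis by (simp only: finite.emptyI)
  next
    case False
    have "compact (complex_of_real ` {0..1})"
      by (intro compact_continuous_image continuous_intros compact_Icc)
    then show ?thesis
      using holomorphic_compact_finite_zeros[OF hol \<open>open S\<close> convex_connected[OF \<open>convex S\<close>] _ KS False]
      by blast
  qed
  have "solvable r F \<pi> (s t)" if "det (M t) \<noteq> 0" for t
    using that unfolding M_def by (rule solvable_if_det_nonzero)
  then have "det (C (of_real t)) = 0" if "t \<in> {0..1}" "\<not> solvable r F \<pi> (s t)" for t
    using that det by force
  then have "of_real ` {t\<in>{0..1}. \<not> solvable r F \<pi> (s t)} \<subseteq> {z \<in> of_real ` {0..1}. det (C z) = 0}"
    by blast
  then have "finite (complex_of_real ` {t\<in>{0..1}. \<not> solvable r F \<pi> (s t)})"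
    using zeros by (rule finite_subset)
  then have "finite {t\<in>{0..1}. \<not> solvable r F \<pi> (s t)}"
    by (rule finite_imageD) (auto simp: inj_on_def)
  then show "finite {t \<in> {0..1}. \<not> solvable r F \<pi> (\<lambda>i. x i + t * (y i - x i))}"
    by (simp add: s_def[abs_def])
qed

section \<open>Sparse block graphs\<close>

definition inner_edges :: "('v \<times> 'v) set \<Rightarrow> ('v \<Rightarrow> 'b) \<Rightarrow> 'b set \<Rightarrow> ('v \<times> 'v) set" where
  "inner_edges F \<pi> W = {e\<in>F. \<pi> (fst e) \<in> W \<and> \<pi> (snd e) \<in> W}"

definition star :: "('v \<times> 'v) set \<Rightarrow> ('v \<Rightarrow> 'b) \<Rightarrow> 'b \<Rightarrow> ('v \<times> 'v) set" where
  "star F \<pi> v = {e\<in>F. \<pi> (fst e) = v \<or> \<pi> (snd e) = v}"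

text \<open>A vertex and not a block, since the abscissa of the far endpoint enters the row.\<close>

definition other_end :: "('v \<Rightarrow> 'b) \<Rightarrow> 'b \<Rightarrow> 'v \<times> 'v \<Rightarrow> 'v" where
  "other_end \<pi> v e = (if \<pi> (fst e) = v then snd e else fst e)"

text \<open>Sparsity of the multigraph whose vertices are the blocks: singletons \<open>W\<close>
  exclude loops, while two blocks may be joined by two parallel edges.\<close>

definition block_sparse :: "('v \<times> 'v) set \<Rightarrow> ('v \<Rightarrow> 'b) \<Rightarrow> 'b set \<Rightarrow> bool" where
  "block_sparse F \<pi> I \<longleftrightarrow> (\<forall>e\<in>F. \<pi> (fst e) \<in> I \<and> \<pi> (snd e) \<in> I) \<and>
     (\<forall>W\<subseteq>I. W \<noteq> {} \<longrightarrow> card (inner_edges F \<pi> W) + 2 \<le> 2 * card W)"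

lemma block_sparse_endpoints: "block_sparse F \<pi> I \<Longrightarrow> e \<in> F \<Longrightarrow> \<pi> (fst e) \<in> I \<and> \<pi> (snd e) \<in> I"
  by (simp add: block_sparse_def)

lemma block_sparse_card: "block_sparse F \<pi> I \<Longrightarrow> W \<subseteq> I \<Longrightarrow> W \<noteq> {} \<Longrightarrow> card (inner_edges F \<pi> W) + 2 \<le> 2 * card W"
  by (simp add: block_sparse_def)

lemma block_sparse_no_loop:
  fixes F :: "('v::finite \<times> 'v) set"
  assumes "block_sparse F \<pi> I" "e \<in> F"
  shows "\<pi> (fst e) \<noteq> \<pi> (snd e)"
proof
  assume eq: "\<pi> (fst e) = \<pi> (snd e)"
  have "card (inner_edges F \<pi> {\<pi> (fst e)}) + 2 \<le> 2 * card {\<pi> (fst e)}"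
    using assms by (intro block_sparse_card) (auto dest: block_sparse_endpoints)
  then have "inner_edges F \<pi> {\<pi> (fst e)} = {}" by simp
  moreover have "e \<in> inner_edges F \<pi> {\<pi> (fst e)}" using eq assms by (simp add: inner_edges_def)
  ultimately show False by simp
qed

lemma block_sparse_subset:
  fixes F :: "('v::finite \<times> 'v) set"
  assumes "block_sparse F \<pi> I" "G \<subseteq> F" "J \<subseteq> I" "\<And>e. e \<in> G \<Longrightarrow> \<pi> (fst e) \<in> J \<and> \<pi> (snd e) \<in> J"
  shows "block_sparse G \<pi> J"
  unfolding block_sparse_def
proof (intro conjI ballI allI impI)
  fix W assume W: "W \<subseteq> J" "W \<noteq> {}"
  have "card (inner_edges G \<pi> W) \<le> card (inner_edges F \<pi> W)"
    using assms(2) by (intro card_mono) (auto simp: inner_edges_def)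
  moreover have "card (inner_edges F \<pi> W) + 2 \<le> 2 * card W"
    using W assms by (intro block_sparse_card[OF assms(1)]) auto
  ultimately show "card (inner_edges G \<pi> W) + 2 \<le> 2 * card W" by simp
qed (use assms(4) in auto)

text \<open>The merged block keeps the name \<open>w\<close> of one of its members, so that the type
  of blocks stays the same throughout the induction.\<close>

definition merge :: "'b set \<Rightarrow> 'b \<Rightarrow> ('v \<Rightarrow> 'b) \<Rightarrow> 'v \<Rightarrow> 'b" where
  "merge W w \<pi> i = (if \<pi> i \<in> W then w else \<pi> i)"

text \<open>The edges inside \<open>W\<close> are solved first. The remaining values are then
  corrected by a field that is constant on \<open>W\<close>, which leaves the values inside
  \<open>W\<close> unchanged.\<close>

lemma solvable_merge:
  assumes "solvable r (inner_edges F \<pi> W) \<pi> x" "solvable r (F - inner_edges F \<pi> W) (merge W w \<pi>) x"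
  shows "solvable r F \<pi> x"
  unfolding solvable_def
proof
  fix \<tau>
  obtain f g where fg: "\<And>e. e \<in> inner_edges F \<pi> W \<Longrightarrow> edge_value r x \<pi> f g e = \<tau> e"
    using assms(1) unfolding solvable_def by meson
  obtain f' g' where fg': "\<And>e. e \<in> F - inner_edges F \<pi> W \<Longrightarrow>
      edge_value r x (merge W w \<pi>) f' g' e = \<tau> e - edge_value r x \<pi> f g e"
    using assms(2)[unfolded solvable_def, rule_format, of "\<lambda>e. \<tau> e - edge_value r x \<pi> f g e"] by blast
  let ?m = "\<lambda>b. if b \<in> W then w else b"
  have eq: "edge_value r x \<pi> (\<lambda>b. f b + f' (?m b)) (\<lambda>b. g b + g' (?m b)) e =
      edge_value r x \<pi> f g e + edge_value r x (merge W w \<pi>) f' g' e" for e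
    by (simp add: edge_value_def merge_def algebra_simps)
  have "edge_value r x \<pi> (\<lambda>b. f b + f' (?m b)) (\<lambda>b. g b + g' (?m b)) e = \<tau> e" if "e \<in> F" for e
  proof (cases "e \<in> inner_edges F \<pi> W")
    case True
    then have "edge_value r x (merge W w \<pi>) f' g' e = 0"
      by (simp add: inner_edges_def edge_value_def merge_def)
    then show ?thesis using fg[OF True] eq by simp
  next
    case False
    then show ?thesis using fg'[of e] that eq by simp
  qed
  then show "\<exists>f g. \<forall>e\<in>F. edge_value r x \<pi> f g e = \<tau> e" by blast
qed

text \<open>A set containing the merged block is expanded by putting all of \<open>W\<close> in
  place of \<open>w\<close>. This adds \<open>card W - 1\<close> blocks and, by tightness,
  \<open>2 * card W - 2\<close> edges, so the bound for the expanded set is the bound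
  wanted.\<close>

lemma block_sparse_merge:
  fixes F :: "('v::finite \<times> 'v) set"
  assumes "finite I" and sp: "block_sparse F \<pi> I" and W: "W \<subseteq> I" "w \<in> W"
    and tight: "card (inner_edges F \<pi> W) + 2 = 2 * card W"
  shows "block_sparse (F - inner_edges F \<pi> W) (merge W w \<pi>) (insert w (I - W))"
  unfolding block_sparse_def
proof (intro conjI ballI allI impI)
  fix Z assume Z: "Z \<subseteq> insert w (I - W)" "Z \<noteq> {}"
  let ?G = "inner_edges (F - inner_edges F \<pi> W) (merge W w \<pi>) Z"
  have finW: "finite W" "finite Z" using assms Z by (auto intro: finite_subset)
  show "card ?G + 2 \<le> 2 * card Z"
  proof (cases "w \<in> Z")
    case True
    let ?Z = "(Z - {w}) \<union> W"
    have ends: "\<pi> i \<in> ?Z" if "merge W w \<pi> i \<in> Z" for i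
      using that W(2) by (cases "\<pi> i \<in> W") (auto simp: merge_def)
    have "card ?G + card (inner_edges F \<pi> W) = card (?G \<union> inner_edges F \<pi> W)"
      by (intro card_Un_disjoint[symmetric]) (auto simp: inner_edges_def)
    also have "\<dots> \<le> card (inner_edges F \<pi> ?Z)"
      by (intro card_mono) (use ends in \<open>auto simp: inner_edges_def\<close>)
    finally have "card ?G + card (inner_edges F \<pi> W) + 2 \<le> 2 * card ?Z"
      using block_sparse_card[OF sp, of ?Z] Z W by fastforce
    moreover have "card ?Z = card (Z - {w}) + card W"
      using finW Z by (intro card_Un_disjoint) auto
    moreover have "card Z = Suc (card (Z - {w}))"
      using True finW by (metis card.remove)
    ultimately show ?thesis using tight by simp
  next
    case False
    then have "?G \<subseteq> inner_edges F \<pi> Z"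
      by (auto simp: inner_edges_def merge_def split: if_splits)
    then have "card ?G \<le> card (inner_edges F \<pi> Z)" by (intro card_mono) auto
    moreover have "card (inner_edges F \<pi> Z) + 2 \<le> 2 * card Z"
      using False Z by (intro block_sparse_card[OF sp]) auto
    ultimately show ?thesis by simp
  qed
qed (use block_sparse_endpoints[OF sp] in \<open>auto simp: merge_def\<close>)

section \<open>Reinserting a block of degree at most 3\<close>

lemma edge_value_star:
  assumes "e \<in> star F \<pi> v" "\<pi> (fst e) \<noteq> \<pi> (snd e)"
  shows "edge_value r x \<pi> f g e = t \<longleftrightarrow>
    f v + (x (fst e) + x (snd e)) powr r * g v =
    f (\<pi> (other_end \<pi> v e)) + (x (fst e) + x (snd e)) powr r * g (\<pi> (other_end \<pi> v e))
      + (if \<pi> (fst e) = v then t else - t)"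
  using assms by (auto simp: star_def other_end_def edge_value_def algebra_simps)

lemma other_end_neq:
  assumes "e \<in> star F \<pi> v" "\<pi> (fst e) \<noteq> \<pi> (snd e)"
  shows "\<pi> (other_end \<pi> v e) \<noteq> v"
  using assms by (auto simp: star_def other_end_def)

lemma edge_value_cong:
  assumes "f (\<pi> (fst e)) = f' (\<pi> (fst e))" "f (\<pi> (snd e)) = f' (\<pi> (snd e))"
    "g (\<pi> (fst e)) = g' (\<pi> (fst e))" "g (\<pi> (snd e)) = g' (\<pi> (snd e))"
    "x (fst e) = x' (fst e)" "x (snd e) = x' (snd e)"
  shows "edge_value r x \<pi> f g e = edge_value r x' \<pi> f' g' e"
  using assms by (simp add: edge_value_def)

lemma affine_interpolation:
  fixes s T :: "'a \<Rightarrow> real"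
  assumes "finite S" "card S \<le> 2" "inj_on s S"
  shows "\<exists>\<alpha> \<beta>. \<forall>e\<in>S. \<alpha> + s e * \<beta> = T e"
proof -
  consider "S = {}" | a where "S = {a}" | a b where "S = {a, b}" "a \<noteq> b"
    using assms(1,2) by (metis One_nat_def Suc_1 card_0_eq card_1_singletonE card_2_iff le_SucE le_zero_eq)
  then show ?thesis
  proof cases
    case 2
    then show ?thesis by (intro exI[of _ "T a"] exI[of _ 0]) simp
  next
    case 3
    then have "s b - s a \<noteq> 0" using assms(3) by auto
    then have "(s b - s a) * ((T b - T a) / (s b - s a)) = T b - T a" by simp
    then have "T a - s a * ((T b - T a) / (s b - s a)) + s b * ((T b - T a) / (s b - s a)) = T b"
      by (simp only: left_diff_distrib)
    then show ?thesis unfolding 3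
      by (intro exI[of _ "T a - s a * ((T b - T a) / (s b - s a))"] exI[of _ "(T b - T a) / (s b - s a)"])
         simp
  qed simp
qed

text \<open>Cramer's rule for three linear equations in \<open>\<alpha>\<close>,
  \<open>\<beta>\<close>, \<open>l\<close>: up to sign, the hypothesis is the nonvanishing of the
  determinant. Geometrically, three lines become concurrent after a suitable shift along
  \<open>(h1, h2, h3)\<close>.\<close>

lemma pencil_interpolation:
  fixes s1 s2 s3 :: real
  assumes "(s2 - s1) * (h3 - h1) \<noteq> (s3 - s1) * (h2 - h1)"
  shows "\<exists>\<alpha> \<beta> l. \<alpha> + s1 * \<beta> = T1 + l * h1 \<and> \<alpha> + s2 * \<beta> = T2 + l * h2 \<and> \<alpha> + s3 * \<beta> = T3 + l * h3"
proof -
  define D where "D = (s2 - s1) * (h3 - h1) - (s3 - s1) * (h2 - h1)"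
  have D: "D \<noteq> 0" using assms by (simp add: D_def)
  define l where "l = ((s3 - s1) * (T2 - T1) - (s2 - s1) * (T3 - T1)) / D"
  define \<beta> where "\<beta> = ((T2 - T1) * (h3 - h1) - (T3 - T1) * (h2 - h1)) / D"
  define \<alpha> where "\<alpha> = T1 + l * h1 - s1 * \<beta>"
  have lD: "l * D = (s3 - s1) * (T2 - T1) - (s2 - s1) * (T3 - T1)"
    and bD: "\<beta> * D = (T2 - T1) * (h3 - h1) - (T3 - T1) * (h2 - h1)"
    using D by (auto simp: l_def \<beta>_def)
  have "D * ((s2 - s1) * \<beta> - (T2 - T1) - l * (h2 - h1))
      = (s2 - s1) * (\<beta> * D) - D * (T2 - T1) - (l * D) * (h2 - h1)"
    by (simp add: algebra_simps)
  also have "\<dots> = 0" unfolding lD bD by (simp add: D_def algebra_simps)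
  finally have 2: "(s2 - s1) * \<beta> - (T2 - T1) - l * (h2 - h1) = 0" using D by simp
  have "D * ((s3 - s1) * \<beta> - (T3 - T1) - l * (h3 - h1))
      = (s3 - s1) * (\<beta> * D) - D * (T3 - T1) - (l * D) * (h3 - h1)"
    by (simp add: algebra_simps)
  also have "\<dots> = 0" unfolding lD bD by (simp add: D_def algebra_simps)
  finally have 3: "(s3 - s1) * \<beta> - (T3 - T1) - l * (h3 - h1) = 0" using D by simp
  show ?thesis
    using 2 3 by (intro exI[of _ \<alpha>] exI[of _ \<beta>] exI[of _ l]) (simp add: \<alpha>_def algebra_simps)
qed

text \<open>At most two equations in the two unknown velocity components of \<open>v\<close>. Their
  coefficients differ because distinct edges have distinct vertex pairs, \<open>asym\<close> ruling
  out both orientations of one pair.\<close>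

lemma solvable_extend_le2:
  fixes F :: "('v::finite \<times> 'v) set"
  assumes r: "r > 0" and "asym F" and no_loop: "\<And>e. e \<in> F \<Longrightarrow> \<pi> (fst e) \<noteq> \<pi> (snd e)"
    and deg: "card (star F \<pi> v) \<le> 2" and pos: "\<And>i. 0 < x i"
    and inj: "\<forall>a b c d. x a + x b = x c + x d \<longrightarrow> {a, b} = {c, d}"
    and sol: "solvable r (F - star F \<pi> v) \<pi> x"
  shows "solvable r F \<pi> x"
  unfolding solvable_def
proof
  fix \<tau>
  obtain f g where fg: "\<And>e. e \<in> F - star F \<pi> v \<Longrightarrow> edge_value r x \<pi> f g e = \<tau> e"
    using sol unfolding solvable_def by meson
  have inj_s: "inj_on (\<lambda>e. (x (fst e) + x (snd e)) powr r) (star F \<pi> v)"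
  proof (rule inj_onI)
    fix e d assume ed: "e \<in> star F \<pi> v" "d \<in> star F \<pi> v"
      and "(x (fst e) + x (snd e)) powr r = (x (fst d) + x (snd d)) powr r"
    then have "x (fst e) + x (snd e) = x (fst d) + x (snd d)"
      using r pos[of "fst e"] pos[of "snd e"] pos[of "fst d"] pos[of "snd d"]
      by (smt (verit) powr_less_mono2)
    then have *: "{fst e, snd e} = {fst d, snd d}" using inj by blast
    have "e \<in> F" "d \<in> F" using ed by (auto simp: star_def)
    then have "(fst e, snd e) \<in> F" "(fst d, snd d) \<in> F" by auto
    then have "\<not> (fst e = snd d \<and> snd e = fst d)" using asymD[OF \<open>asym F\<close>] by metis
    then have "fst e = fst d \<and> snd e = snd d" using * unfolding doubleton_eq_iff by blast
    then show "e = d" by (simp add: prod_eq_iff)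
  qed
  have "\<exists>\<alpha> \<beta>. \<forall>e\<in>star F \<pi> v. \<alpha> + (x (fst e) + x (snd e)) powr r * \<beta> =
     f (\<pi> (other_end \<pi> v e)) + (x (fst e) + x (snd e)) powr r * g (\<pi> (other_end \<pi> v e))
      + (if \<pi> (fst e) = v then \<tau> e else - \<tau> e)"
    by (intro affine_interpolation deg inj_s) simp
  then obtain \<alpha> \<beta> where ab: "\<forall>e\<in>star F \<pi> v. \<alpha> + (x (fst e) + x (snd e)) powr r * \<beta> =
     f (\<pi> (other_end \<pi> v e)) + (x (fst e) + x (snd e)) powr r * g (\<pi> (other_end \<pi> v e))
      + (if \<pi> (fst e) = v then \<tau> e else - \<tau> e)"
    by (elim exE)
  have "edge_value r x \<pi> (f(v := \<alpha>)) (g(v := \<beta>)) e = \<tau> e" if e: "e \<in> F" for e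
  proof (cases "e \<in> star F \<pi> v")
    case True
    show ?thesis
      unfolding edge_value_star[OF True no_loop[OF e]]
      using bspec[OF ab True] other_end_neq[OF True no_loop[OF e]] by simp
  next
    case False
    then have "edge_value r x \<pi> (f(v := \<alpha>)) (g(v := \<beta>)) e = edge_value r x \<pi> f g e"
      using e by (intro edge_value_cong) (auto simp: star_def)
    then show ?thesis using fg[of e] e False by simp
  qed
  then show "\<exists>f g. \<forall>e\<in>F. edge_value r x \<pi> f g e = \<tau> e" by blast
qed

text \<open>\<open>(h, k)\<close> is a motion of the graph without \<open>v\<close>. Adding
  \<open>l\<close> times this motion changes no value outside the star and provides the third
  unknown for the three equations at \<open>v\<close>.\<close>

lemma solvable_extend_3:
  fixes F :: "('v::finite \<times> 'v) set"
  assumes r: "r > 0" "r \<noteq> 1" and no_loop: "\<And>e. e \<in> F \<Longrightarrow> \<pi> (fst e) \<noteq> \<pi> (snd e)"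
    and st: "star F \<pi> v = {e1, e2, e3}" and pos: "\<And>i. 0 < x i" and inj: "inj x"
    and abc: "a = other_end \<pi> v e1" "b = other_end \<pi> v e2" "c = other_end \<pi> v e3"
      "a \<noteq> b" "b \<noteq> c" "a \<noteq> c"
    and sol: "solvable r (F - star F \<pi> v) \<pi> x"
    and ker: "\<And>e. e \<in> F - star F \<pi> v \<Longrightarrow> edge_value r x \<pi> h k e = 0"
    and nontriv: "\<not> (h (\<pi> a) = h (\<pi> b) \<and> h (\<pi> b) = h (\<pi> c) \<and> k (\<pi> a) = k (\<pi> b) \<and> k (\<pi> b) = k (\<pi> c))"
  shows "\<exists>x. (\<forall>i. 0 < x i) \<and> solvable r F \<pi> x"
proof -
  have "x a \<noteq> x b" "x b \<noteq> x c" "x a \<noteq> x c" using abc inj by (auto dest: injD)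
  then have "\<exists>z>0. ((z + x b) powr r - (z + x a) powr r) *
        ((h (\<pi> c) + (z + x c) powr r * k (\<pi> c)) - (h (\<pi> a) + (z + x a) powr r * k (\<pi> a))) \<noteq>
      ((z + x c) powr r - (z + x a) powr r) *
        ((h (\<pi> b) + (z + x b) powr r * k (\<pi> b)) - (h (\<pi> a) + (z + x a) powr r * k (\<pi> a)))"
    by (intro exists_noncollapsing_shift pos r nontriv)
  then obtain z where z: "z > 0" "((z + x b) powr r - (z + x a) powr r) *
        ((h (\<pi> c) + (z + x c) powr r * k (\<pi> c)) - (h (\<pi> a) + (z + x a) powr r * k (\<pi> a))) \<noteq>
      ((z + x c) powr r - (z + x a) powr r) *
        ((h (\<pi> b) + (z + x b) powr r * k (\<pi> b)) - (h (\<pi> a) + (z + x a) powr r * k (\<pi> a)))"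
    by (elim exE conjE)
  \<comment> \<open>All vertices of the block \<open>v\<close> get the same abscissa. No edge of
    \<open>F\<close> joins two of them, and only the existence of a solvable placement is passed on,
    from which \<open>solvable_generic\<close> recovers generic ones.\<close>
  define y where "y i = (if \<pi> i = v then z else x i)" for i
  have "solvable r F \<pi> y"
    unfolding solvable_def
  proof
    fix \<tau>
    obtain f g where fg: "\<And>e. e \<in> F - star F \<pi> v \<Longrightarrow> edge_value r x \<pi> f g e = \<tau> e"
      using sol unfolding solvable_def by meson
    define T where "T e = (let w = other_end \<pi> v e in
      f (\<pi> w) + (z + x w) powr r * g (\<pi> w) + (if \<pi> (fst e) = v then \<tau> e else - \<tau> e))" for e
    let ?P = "\<lambda>\<alpha> \<beta> l. \<alpha> + (z + x a) powr r * \<beta> = T e1 + l * (h (\<pi> a) + (z + x a) powr r * k (\<pi> a)) \<and>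
      \<alpha> + (z + x b) powr r * \<beta> = T e2 + l * (h (\<pi> b) + (z + x b) powr r * k (\<pi> b)) \<and>
      \<alpha> + (z + x c) powr r * \<beta> = T e3 + l * (h (\<pi> c) + (z + x c) powr r * k (\<pi> c))"
    have "\<exists>\<alpha> \<beta> l. ?P \<alpha> \<beta> l"
      by (rule pencil_interpolation[OF z(2)])
    then obtain \<alpha> \<beta> l where abl: "?P \<alpha> \<beta> l"
      by (elim exE)
    have star_eq: "\<alpha> + (z + x (other_end \<pi> v e)) powr r * \<beta> = T e
        + l * (h (\<pi> (other_end \<pi> v e)) + (z + x (other_end \<pi> v e)) powr r * k (\<pi> (other_end \<pi> v e)))"
      if "e \<in> star F \<pi> v" for e
    proof -
      have "e \<in> {e1, e2, e3}" using that by (simp only: st)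
      then consider "e = e1" | "e = e2" | "e = e3" by blast
      then show ?thesis by cases (use abl in \<open>simp_all only: abc\<close>)
    qed
    let ?f = "\<lambda>b. if b = v then \<alpha> else f b + l * h b"
    let ?g = "\<lambda>b. if b = v then \<beta> else g b + l * k b"
    have "edge_value r y \<pi> ?f ?g e = \<tau> e" if e: "e \<in> F" for e
    proof (cases "e \<in> star F \<pi> v")
      case True
      have ne: "\<pi> (other_end \<pi> v e) \<noteq> v" by (rule other_end_neq[OF True no_loop[OF e]])
      then have y: "y (fst e) + y (snd e) = z + x (other_end \<pi> v e)"
        using True by (auto simp: y_def other_end_def star_def)
      show ?thesis
        unfolding edge_value_star[OF True no_loop[OF e]] y
        using star_eq[OF True] ne by (simp add: T_def Let_def algebra_simps)
    next
      case False
      then have "edge_value r y \<pi> ?f ?g e = edge_value r x \<pi> (\<lambda>b. f b + l * h b) (\<lambda>b. g b + l * k b) e"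
        using e by (intro edge_value_cong) (auto simp: star_def y_def)
      also have "\<dots> = edge_value r x \<pi> f g e + l * edge_value r x \<pi> h k e"
        by (simp add: edge_value_def algebra_simps)
      finally show ?thesis using fg[of e] ker[of e] e False by simp
    qed
    then show "\<exists>f g. \<forall>e\<in>F. edge_value r y \<pi> f g e = \<tau> e" by blast
  qed
  then show ?thesis using pos z(1) by (intro exI[of _ y]) (simp add: y_def)
qed

lemma sum_card_star:
  fixes F :: "('v::finite \<times> 'v) set"
  assumes "finite I" and sp: "block_sparse F \<pi> I"
  shows "(\<Sum>v\<in>I. card (star F \<pi> v)) = 2 * card F"
proof -
  have "card (star F \<pi> v) = card {e\<in>F. \<pi> (fst e) = v} + card {e\<in>F. \<pi> (snd e) = v}" for v
  proof -
    have "star F \<pi> v = {e\<in>F. \<pi> (fst e) = v} \<union> {e\<in>F. \<pi> (snd e) = v}"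
      by (auto simp: star_def)
    moreover have "{e\<in>F. \<pi> (fst e) = v} \<inter> {e\<in>F. \<pi> (snd e) = v} = {}"
    proof (rule equals0I)
      fix e assume "e \<in> {e\<in>F. \<pi> (fst e) = v} \<inter> {e\<in>F. \<pi> (snd e) = v}"
      then have "e \<in> F" "\<pi> (fst e) = \<pi> (snd e)" by auto
      then show False using block_sparse_no_loop[OF sp] by metis
    qed
    ultimately show ?thesis
      by (simp add: card_Un_disjoint)
  qed
  moreover have "(\<Sum>v\<in>I. card {e\<in>F. \<pi> (fst e) = v}) = card F"
  proof -
    have "(\<lambda>e. \<pi> (fst e)) ` F \<subseteq> I" using block_sparse_endpoints[OF sp] by blast
    then show ?thesis using sum.group[of F I "\<lambda>e. \<pi> (fst e)" "\<lambda>_. 1::nat"] assms(1) by simp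
  qed
  moreover have "(\<Sum>v\<in>I. card {e\<in>F. \<pi> (snd e) = v}) = card F"
  proof -
    have "(\<lambda>e. \<pi> (snd e)) ` F \<subseteq> I" using block_sparse_endpoints[OF sp] by blast
    then show ?thesis using sum.group[of F I "\<lambda>e. \<pi> (snd e)" "\<lambda>_. 1::nat"] assms(1) by simp
  qed
  ultimately show ?thesis by (simp add: sum.distrib)
qed

text \<open>Induction on the number of blocks. A proper tight set of blocks is merged into one block. Otherwise
  some block \<open>v\<close> has degree at most 3; for degree 3 either two of its neighbours are not adjacent, and the
  new edge between them yields the motion needed for \<open>exists_noncollapsing_shift\<close>, or the whole graph is
  \<open>K\<^sub>4\<close> and this motion is written down explicitly.\<close>

lemma block_sparse_solvable:
  fixes F :: "('v::finite \<times> 'v) set" and I :: "'b set"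
  assumes r: "r > 0" "r \<noteq> 1"
  shows "finite I \<Longrightarrow> block_sparse F \<pi> I \<Longrightarrow> asym F \<Longrightarrow> \<exists>x. (\<forall>i. 0 < x i) \<and> solvable r F \<pi> x"
proof (induction "card I" arbitrary: I F \<pi> rule: less_induct)
  case less
  note fin = less.prems(1) and sp = less.prems(2) and asym = less.prems(3)
  note no_loop = block_sparse_no_loop[OF sp]
  \<comment> \<open>The placement from the induction hypothesis is made generic at once, because the
    cases below impose several conditions on a single \<open>x\<close>.\<close>
  have generic_IH: "generic (solvable r G \<rho>)"
    if "card J < card I" "finite J" "block_sparse G \<rho> J" "asym G" for J :: "'b set" and G :: "('v \<times> 'v) set" and \<rho>
    using less.hyps[OF that] solvable_generic by blast
  show ?case
  proof (cases "F = {}")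
    case True
    then show ?thesis by (intro exI[of _ "\<lambda>_. 1"]) (simp add: solvable_def)
  next
    case False
    then obtain e0 where "e0 \<in> F" by blast
    then have ne: "I \<noteq> {}" using block_sparse_endpoints[OF sp] by blast
    show ?thesis
    \<comment> \<open>A singleton is always tight and \<open>I\<close> itself may be; only a tight
      set strictly in between splits the graph into two with fewer blocks.\<close>
    proof (cases "\<exists>W. W \<subset> I \<and> 2 \<le> card W \<and> card (inner_edges F \<pi> W) + 2 = 2 * card W")
      case True
      then obtain W where W: "W \<subset> I" "2 \<le> card W" "card (inner_edges F \<pi> W) + 2 = 2 * card W"
        by blast
      then obtain w where w: "w \<in> W" by fastforce
      have finW: "finite W" using W fin by (meson finite_subset psubsetE)
      have g1: "generic (solvable r (inner_edges F \<pi> W) \<pi>)"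
      proof (rule generic_IH)
        show "block_sparse (inner_edges F \<pi> W) \<pi> W"
          using W by (intro block_sparse_subset[OF sp]) (auto simp: inner_edges_def)
        show "asym (inner_edges F \<pi> W)"
          using asym by (auto simp: inner_edges_def intro!: asymI dest: asymD)
      qed (use W fin finW in \<open>auto intro: psubset_card_mono\<close>)
      have g2: "generic (solvable r (F - inner_edges F \<pi> W) (merge W w \<pi>))"
      proof (rule generic_IH)
        have "card (insert w (I - W)) = Suc (card (I - W))" using fin w by simp
        also have "card (I - W) = card I - card W" using W finW by (intro card_Diff_subset) auto
        finally show "card (insert w (I - W)) < card I"
          using W fin psubset_card_mono[OF fin W(1)] by linarith
        show "block_sparse (F - inner_edges F \<pi> W) (merge W w \<pi>) (insert w (I - W))"
          using W w by (intro block_sparse_merge fin sp) auto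
        show "asym (F - inner_edges F \<pi> W)"
          using asym by (auto intro!: asymI dest: asymD)
      qed (use fin in simp)
      obtain x where x: "\<forall>i. 0 < x i" "solvable r (inner_edges F \<pi> W) \<pi> x"
        "solvable r (F - inner_edges F \<pi> W) (merge W w \<pi>) x"
        using generic_witness[OF generic_conj[OF g1 g2]] by (elim exE conjE)
      then show ?thesis using solvable_merge[OF x(2,3)] by (intro exI[of _ x] conjI)
    next
      case False
      \<comment> \<open>Every proper set of at least two blocks now has room for one more
        edge.\<close>
      then have slack: "card (inner_edges F \<pi> W) + 3 \<le> 2 * card W" if "W \<subset> I" "2 \<le> card W" for W
        using that block_sparse_card[OF sp, of W] by fastforce
      have F_inner: "F = inner_edges F \<pi> I"
        using block_sparse_endpoints[OF sp] by (auto simp: inner_edges_def)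
      \<comment> \<open>If all degrees were at least 4, counting ends of edges would give
        \<open>4 * card I \<le> 2 * card F \<le> 4 * card I - 4\<close>.\<close>
      have "\<exists>v\<in>I. card (star F \<pi> v) \<le> 3"
      proof (rule ccontr)
        assume "\<not> ?thesis"
        then have "(\<Sum>v\<in>I. 4) \<le> (\<Sum>v\<in>I. card (star F \<pi> v))" by (intro sum_mono) force
        then have "4 * card I \<le> 2 * card F" by (simp add: sum_card_star[OF fin sp])
        moreover have "card F + 2 \<le> 2 * card I"
          using block_sparse_card[OF sp, of I] ne F_inner by simp
        ultimately show False by simp
      qed
      then obtain v where v: "v \<in> I" "card (star F \<pi> v) \<le> 3" by blast
      have vcard: "card (I - {v}) < card I" using v fin by (intro psubset_card_mono) auto
      have rest_ends: "\<pi> (fst e) \<in> I - {v} \<and> \<pi> (snd e) \<in> I - {v}" if "e \<in> F - star F \<pi> v" for e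
        using that block_sparse_endpoints[OF sp] by (auto simp: star_def)
      have rest_sp: "block_sparse (F - star F \<pi> v) \<pi> (I - {v})"
        using rest_ends by (intro block_sparse_subset[OF sp]) auto
      have rest: "generic (solvable r (F - star F \<pi> v) \<pi>)"
        using vcard fin rest_sp asym by (intro generic_IH) (auto intro!: asymI dest: asymD)
      show ?thesis
      proof (cases "card (star F \<pi> v) \<le> 2")
        case True
        from generic_witness[OF generic_conj[OF rest generic_sum_inj]] obtain x where
          x: "\<forall>i. 0 < x i" "solvable r (F - star F \<pi> v) \<pi> x"
            "\<forall>a b c d. x a + x b = x c + x d \<longrightarrow> {a, b} = {c, d}" by blast
        have "solvable r F \<pi> x"
          using solvable_extend_le2[OF r(1) asym no_loop True _ x(3,2)] x(1) by blast
        then show ?thesis using x(1) by blast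
      next
        case False
        then have "card (star F \<pi> v) = 3" using v by simp
        then obtain e1 e2 e3 where st: "star F \<pi> v = {e1, e2, e3}" "e1 \<noteq> e2" "e2 \<noteq> e3" "e1 \<noteq> e3"
          by (auto simp: card_3_iff)
        let ?o = "other_end \<pi> v"
        have star_F: "e \<in> F" if "e \<in> star F \<pi> v" for e using that by (simp add: star_def)
        have o_ne: "\<pi> (?o e) \<noteq> v" if "e \<in> star F \<pi> v" for e
          using other_end_neq[OF that no_loop[OF star_F[OF that]]] .
        have o_I: "\<pi> (?o e) \<in> I" if "e \<in> star F \<pi> v" for e
          using block_sparse_endpoints[OF sp star_F[OF that]] by (simp add: other_end_def)
        have star_inner: "e \<in> inner_edges F \<pi> W" if "e \<in> star F \<pi> v" "v \<in> W" "\<pi> (?o e) \<in> W" for e W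
          using that by (auto simp: star_def inner_edges_def other_end_def split: if_splits)
        \<comment> \<open>Two edges from \<open>v\<close> to one block would make that pair of
          blocks tight. By \<open>slack\<close> the pair would be all of \<open>I\<close>, leaving
          at most two edges in total against three at \<open>v\<close>.\<close>
        have o_distinct: "\<pi> (?o e) \<noteq> \<pi> (?o d)" if ed: "e \<in> star F \<pi> v" "d \<in> star F \<pi> v" "e \<noteq> d" for e d
        proof
          assume eq: "\<pi> (?o e) = \<pi> (?o d)"
          let ?Z = "{v, \<pi> (?o e)}"
          have Z: "card ?Z = 2" "?Z \<subseteq> I" using o_ne[OF ed(1)] o_I[OF ed(1)] v by auto
          have "{e, d} \<subseteq> inner_edges F \<pi> ?Z" using eq star_inner ed by auto
          then have "card {e, d} \<le> card (inner_edges F \<pi> ?Z)" by (intro card_mono) auto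
          then have c2: "2 \<le> card (inner_edges F \<pi> ?Z)" using ed by simp
          have "?Z = I"
          proof (rule ccontr)
            assume "?Z \<noteq> I"
            then show False using slack[of ?Z] Z c2 by auto
          qed
          then have "card F + 2 \<le> 2 * 2" using block_sparse_card[OF sp, of ?Z] F_inner Z(1) ne by simp
          moreover have "card (star F \<pi> v) \<le> card F" by (intro card_mono) (auto simp: star_def)
          ultimately show False using \<open>card (star F \<pi> v) = 3\<close> by simp
        qed
        define a b c where "a = ?o e1" and "b = ?o e2" and "c = ?o e3"
        have pd: "\<pi> a \<noteq> \<pi> b" "\<pi> b \<noteq> \<pi> c" "\<pi> a \<noteq> \<pi> c"
          using o_distinct st by (auto simp: a_def b_def c_def)
        have pne: "\<pi> a \<noteq> v" "\<pi> b \<noteq> v" "\<pi> c \<noteq> v" and pI: "\<pi> a \<in> I" "\<pi> b \<in> I" "\<pi> c \<in> I"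
          using o_ne o_I st by (auto simp: a_def b_def c_def)
        have finish: ?thesis
          if "\<forall>i. 0 < x i" "solvable r (F - star F \<pi> v) \<pi> x"
            "\<forall>a b c d. x a + x b = x c + x d \<longrightarrow> {a, b} = {c, d}"
            "\<forall>e\<in>F - star F \<pi> v. edge_value r x \<pi> h k e = 0"
            "\<not> (h (\<pi> a) = h (\<pi> b) \<and> h (\<pi> b) = h (\<pi> c) \<and> k (\<pi> a) = k (\<pi> b) \<and> k (\<pi> b) = k (\<pi> c))"
          for x h k
        proof (rule solvable_extend_3[OF r no_loop st(1) _ _ a_def b_def c_def _ _ _ that(2) _ that(5)])
          show "inj x"
          proof (rule injI)
            fix i j assume "x i = x j"
            then have "{i, i} = {j, j}" using that(3) by metis
            then show "i = j" by simp
          qed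
        qed (use that pd in auto)
        show ?thesis
        proof (cases "\<exists>i j. i \<in> {a, b, c} \<and> j \<in> {a, b, c} \<and> i \<noteq> j \<and> (i, j) \<notin> F \<and> (j, i) \<notin> F")
          case True
          then obtain i j where ij: "i \<in> {a, b, c}" "j \<in> {a, b, c}" "i \<noteq> j" "(i, j) \<notin> F" "(j, i) \<notin> F"
            by blast
          have pij: "\<pi> i \<noteq> \<pi> j" "\<pi> i \<in> I - {v}" "\<pi> j \<in> I - {v}"
            using ij pd pne pI by auto
          \<comment> \<open>The sets counted here avoid \<open>v\<close>, hence are proper and have
            room for the new edge. Only the pair of vertices must be new; the blocks of
            \<open>i\<close> and \<open>j\<close> may already be joined by another edge.\<close>
          let ?F = "insert (i, j) (F - star F \<pi> v)"
          have "block_sparse ?F \<pi> (I - {v})"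
            unfolding block_sparse_def
          proof (intro conjI ballI allI impI)
            fix W assume W: "W \<subseteq> I - {v}" "W \<noteq> {}"
            show "card (inner_edges ?F \<pi> W) + 2 \<le> 2 * card W"
            proof (cases "\<pi> i \<in> W \<and> \<pi> j \<in> W")
              case True
              have finW: "finite W" using W fin by (auto intro: finite_subset)
              have "card {\<pi> i, \<pi> j} \<le> card W" using True finW by (intro card_mono) auto
              then have "card (inner_edges F \<pi> W) + 3 \<le> 2 * card W"
                using W v pij by (intro slack) auto
              moreover have "card (inner_edges ?F \<pi> W) \<le> card (insert (i, j) (inner_edges F \<pi> W))"
                by (intro card_mono) (auto simp: inner_edges_def)
              moreover have "card (insert (i, j) (inner_edges F \<pi> W)) \<le> Suc (card (inner_edges F \<pi> W))"
                by (rule card_insert_le_m1) auto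
              ultimately show ?thesis by linarith
            next
              case False
              then have "inner_edges ?F \<pi> W = inner_edges (F - star F \<pi> v) \<pi> W"
                by (auto simp: inner_edges_def)
              then show ?thesis using block_sparse_card[OF rest_sp W] by simp
            qed
          qed (use rest_ends pij in auto)
          moreover have "asym ?F"
            using asym ij by (auto intro!: asymI dest: asymD)
          ultimately have "generic (solvable r ?F \<pi>)"
            using vcard fin by (intro generic_IH) auto
          from generic_witness[OF generic_conj[OF this generic_sum_inj]] obtain x where
            x: "\<forall>i. 0 < x i" "solvable r ?F \<pi> x"
              "\<forall>a b c d. x a + x b = x c + x d \<longrightarrow> {a, b} = {c, d}" by blast
          \<comment> \<open>The field dual to the new edge changes its length to first order and
            preserves all old edges, so it is not constant on the neighbours of
            \<open>v\<close>.\<close>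
          obtain h k where hk: "\<forall>e\<in>?F. edge_value r x \<pi> h k e = (if e = (i, j) then 1 else 0)"
            using x(2)[unfolded solvable_def, rule_format, of "\<lambda>e. if e = (i, j) then 1 else 0"] by blast
          have "edge_value r x \<pi> h k (i, j) = 1" using hk by simp
          then have "\<not> (h (\<pi> i) = h (\<pi> j) \<and> k (\<pi> i) = k (\<pi> j))" by (auto simp: edge_value_def)
          then have "\<not> (h (\<pi> a) = h (\<pi> b) \<and> h (\<pi> b) = h (\<pi> c) \<and> k (\<pi> a) = k (\<pi> b) \<and> k (\<pi> b) = k (\<pi> c))"
            using ij by auto
          moreover have "\<forall>e\<in>F - star F \<pi> v. edge_value r x \<pi> h k e = 0"
            using hk ij by auto
          moreover have "solvable r (F - star F \<pi> v) \<pi> x"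
            using x(2) by (rule solvable_mono) auto
          ultimately show ?thesis using finish x by blast
        next
          case False
          have ne: "a \<noteq> b" "b \<noteq> c" "a \<noteq> c" using pd by auto
          obtain d1 where d1: "d1 \<in> F" "d1 = (a, b) \<or> d1 = (b, a)" using False ne by blast
          obtain d2 where d2: "d2 \<in> F" "d2 = (b, c) \<or> d2 = (c, b)" using False ne by blast
          obtain d3 where d3: "d3 \<in> F" "d3 = (a, c) \<or> d3 = (c, a)" using False ne by blast
          \<comment> \<open>Three edges at \<open>v\<close> and three among its neighbours make
            these four blocks tight, so by \<open>slack\<close> they are all blocks, and the six
            edges are all edges.\<close>
          let ?Z = "{v, \<pi> a, \<pi> b, \<pi> c}"
          have Zc: "card ?Z = 4" using pd pne by simp
          have dd: "d1 \<noteq> d2" "d2 \<noteq> d3" "d1 \<noteq> d3" using d1 d2 d3 ne by auto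
          have dns: "d1 \<notin> star F \<pi> v" "d2 \<notin> star F \<pi> v" "d3 \<notin> star F \<pi> v"
            using d1 d2 d3 pne by (auto simp: star_def)
          have c6: "card ({d1, d2, d3} \<union> star F \<pi> v) = 6"
            using dd dns \<open>card (star F \<pi> v) = 3\<close> by (subst card_Un_disjoint) auto
          have "{d1, d2, d3} \<union> star F \<pi> v \<subseteq> inner_edges F \<pi> ?Z"
          proof -
            have "star F \<pi> v \<subseteq> inner_edges F \<pi> ?Z"
              using star_inner[of e1 ?Z] star_inner[of e2 ?Z] star_inner[of e3 ?Z] unfolding st(1)
              by (simp add: a_def b_def c_def)
            moreover have "{d1, d2, d3} \<subseteq> inner_edges F \<pi> ?Z"
              using d1 d2 d3 unfolding inner_edges_def by auto
            ultimately show ?thesis by (rule Un_least[rotated])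
          qed
          then have "card ({d1, d2, d3} \<union> star F \<pi> v) \<le> card (inner_edges F \<pi> ?Z)" by (intro card_mono) auto
          then have "6 \<le> card (inner_edges F \<pi> ?Z)" using c6 by simp
          then have "?Z = I"
            using slack[of ?Z] Zc pI v by fastforce
          then have "card F \<le> 6"
            using block_sparse_card[OF sp, of I] ne F_inner Zc by fastforce
          then have F_eq: "{d1, d2, d3} \<union> star F \<pi> v = F"
            using d1 d2 d3 c6 by (intro card_seteq) (auto simp: star_def)
          from generic_witness[OF generic_conj[OF rest generic_sum_inj]] obtain x where
            x: "\<forall>i. 0 < x i" "solvable r (F - star F \<pi> v) \<pi> x"
              "\<forall>a b c d. x a + x b = x c + x d \<longrightarrow> {a, b} = {c, d}" by blast
          define sab sbc sac where "sab = (x a + x b) powr r" and "sbc = (x b + x c) powr r"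
            and "sac = (x a + x c) powr r"
          \<comment> \<open>The block of \<open>c\<close> is held fixed. The edges to
            \<open>c\<close> force \<open>h = - sac * k\<close> at \<open>a\<close> and
            \<open>h = - sbc * k\<close> at \<open>b\<close>; the edge between \<open>a\<close> and
            \<open>b\<close> then gives the ratio of \<open>k\<close> as \<open>sab - sbc\<close> to
            \<open>sab - sac\<close>.\<close>
          define k where "k i = (if i = \<pi> a then sab - sbc else if i = \<pi> b then sab - sac else 0)" for i
          define h where "h i = (if i = \<pi> a then - sac * (sab - sbc)
              else if i = \<pi> b then - sbc * (sab - sac) else 0)" for i
          have "edge_value r x \<pi> h k e = 0" if "e \<in> {d1, d2, d3}" for e
          proof -
            have s: "(x b + x a) powr r = sab" "(x c + x b) powr r = sbc" "(x c + x a) powr r = sac"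
              by (simp_all add: sab_def sbc_def sac_def add.commute)
            have "h (\<pi> a) - h (\<pi> b) + sab * (k (\<pi> a) - k (\<pi> b)) = 0"
              "h (\<pi> b) - h (\<pi> c) + sbc * (k (\<pi> b) - k (\<pi> c)) = 0"
              "h (\<pi> a) - h (\<pi> c) + sac * (k (\<pi> a) - k (\<pi> c)) = 0"
              using pd by (auto simp: h_def k_def algebra_simps)
            then show ?thesis
              using that d1(2) d2(2) d3(2)
              by (auto simp: edge_value_def s sab_def[symmetric] sbc_def[symmetric] sac_def[symmetric] algebra_simps)
          qed
          then have "\<forall>e\<in>F - star F \<pi> v. edge_value r x \<pi> h k e = 0" using F_eq by blast
          moreover have "k (\<pi> a) \<noteq> k (\<pi> c)"
          proof -
            have "x a + x b \<noteq> x b + x c" using x(3) ne by (metis doubleton_eq_iff)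
            then have "sab \<noteq> sbc"
              using r(1) x(1) unfolding sab_def sbc_def
              by (smt (verit) powr_less_mono2)
            then show ?thesis using pd by (simp add: k_def)
          qed
          ultimately show ?thesis using finish x by metis
        qed
      qed
    qed
  qed
qed

section \<open>Infinitesimal flexes in the plane with the q-norm\<close>

lemma has_real_derivative_abs_powr:
  fixes q y :: real
  assumes q: "1 < q"
  shows "((\<lambda>y. \<bar>y\<bar> powr q) has_real_derivative q * (sgn y * \<bar>y\<bar> powr (q - 1))) (at y)"
proof -
  consider "y > 0" | "y < 0" | "y = 0" by linarith
  then show ?thesis
  proof cases
    case 1
    have "((\<lambda>y. y powr q) has_real_derivative q * y powr (q - 1)) (at y)"
      using 1 by (rule has_real_derivative_powr)
    moreover have "\<forall>\<^sub>F y in nhds y. y powr q = \<bar>y\<bar> powr q"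
      using eventually_nhds_in_open[of "{0<..}" y] 1 by (auto elim!: eventually_mono)
    ultimately show ?thesis
      using 1 by (subst DERIV_cong_ev[OF refl _ refl, of _ "\<lambda>y. y powr q"]) (auto elim: eventually_mono)
  next
    case 2
    have "((\<lambda>y. (- y) powr q) has_real_derivative - (q * (- y) powr (q - 1))) (at y)"
      using 2 by (auto intro!: derivative_eq_intros simp: powr_diff)
    moreover have "\<forall>\<^sub>F y in nhds y. (- y) powr q = \<bar>y\<bar> powr q"
      using eventually_nhds_in_open[of "{..<0}" y] 2 by (auto elim!: eventually_mono)
    ultimately show ?thesis
      using 2 by (subst DERIV_cong_ev[OF refl _ refl, of _ "\<lambda>y. (- y) powr q"]) (auto elim: eventually_mono)
  next
    case 3
    have "((\<lambda>h. \<bar>h\<bar> powr (q - 1)) \<longlongrightarrow> \<bar>0\<bar> powr (q - 1)) (at (0::real))"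
      by (intro tendsto_powr' tendsto_rabs tendsto_ident_at tendsto_const) (use q in auto)
    then have lim: "((\<lambda>h. \<bar>h\<bar> powr (q - 1)) \<longlongrightarrow> 0) (at (0::real))"
      using q by simp
    have "((\<lambda>h. \<bar>h\<bar> powr q / h) \<longlongrightarrow> 0) (at (0::real))"
    proof (rule Lim_null_comparison[OF _ lim])
      show "\<forall>\<^sub>F h in at (0::real). norm (\<bar>h\<bar> powr q / h) \<le> \<bar>h\<bar> powr (q - 1)"
        by (auto simp: eventually_at_filter powr_diff)
    qed
    then show ?thesis using 3 q by (simp add: DERIV_def)
  qed
qed

lemma lq_norm_0: "lq_norm q 0 = 0"
  by (simp add: lq_norm_def)

lemma lq_norm_powr:
  assumes "q > 0" shows "lq_norm q x powr q = (\<Sum>k\<in>UNIV. \<bar>x $ k\<bar> powr q)"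
  using assms by (simp add: lq_norm_def powr_powr sum_nonneg)

lemma component_le_lq_norm:
  assumes "q > 0" shows "\<bar>x $ k\<bar> \<le> lq_norm q x"
proof -
  have "\<bar>x $ k\<bar> powr q \<le> (\<Sum>k\<in>UNIV. \<bar>x $ k\<bar> powr q)"
    by (rule member_le_sum) auto
  then have "(\<bar>x $ k\<bar> powr q) powr (1 / q) \<le> lq_norm q x"
    unfolding lq_norm_def using assms by (intro powr_mono2) auto
  then show ?thesis using assms by (simp add: powr_powr)
qed

lemma lq_norm_eq_0_iff:
  assumes "q > 0" shows "lq_norm q x = 0 \<longleftrightarrow> x = 0"
proof
  assume "lq_norm q x = 0"
  then show "x = 0" using component_le_lq_norm[OF assms, of x] by (simp add: vec_eq_iff)
qed (simp add: lq_norm_0)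

lemma lq_norm_scaleR:
  assumes "q > 0" shows "lq_norm q (t *\<^sub>R x) = \<bar>t\<bar> * lq_norm q x"
proof -
  have "(\<Sum>k\<in>UNIV. \<bar>(t *\<^sub>R x) $ k\<bar> powr q) = \<bar>t\<bar> powr q * (\<Sum>k\<in>UNIV. \<bar>x $ k\<bar> powr q)"
    by (simp add: abs_mult powr_mult sum_distrib_left)
  then show ?thesis
    using assms by (simp add: lq_norm_def powr_mult powr_powr sum_nonneg)
qed

lemma has_path_derivative_component:
  fixes c :: "real \<Rightarrow> real ^ 'd"
  assumes "q > 0" "has_path_derivative_at_0 (lq_norm q) c v"
  shows "((\<lambda>t. c t $ k) has_real_derivative v $ k) (at 0)"
proof -
  have "((\<lambda>t. (c t $ k - c 0 $ k) / t - v $ k) \<longlongrightarrow> 0) (at 0)"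
  proof (rule Lim_null_comparison)
    show "((\<lambda>t. lq_norm q ((c t - c 0) /\<^sub>R t - v)) \<longlongrightarrow> 0) (at 0)"
      using assms(2) by (simp add: has_path_derivative_at_0_def)
    have "norm ((c t $ k - c 0 $ k) / t - v $ k) \<le> lq_norm q ((c t - c 0) /\<^sub>R t - v)" for t
      using component_le_lq_norm[OF assms(1), of "(c t - c 0) /\<^sub>R t - v" k]
      by (simp add: divide_inverse mult.commute)
    then show "\<forall>\<^sub>F t in at 0. norm ((c t $ k - c 0 $ k) / t - v $ k) \<le> lq_norm q ((c t - c 0) /\<^sub>R t - v)"
      by simp
  qed
  then have "((\<lambda>t. (c t $ k - c 0 $ k) / t) \<longlongrightarrow> v $ k) (at 0)"
    by (rule Lim_null[THEN iffD2])
  then show ?thesis by (simp add: DERIV_def)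
qed

lemma has_path_derivative_unique:
  fixes c :: "real \<Rightarrow> real ^ 'd"
  assumes "q > 0" "has_path_derivative_at_0 (lq_norm q) c v" "has_path_derivative_at_0 (lq_norm q) c w"
  shows "v = w"
  using has_path_derivative_component[OF assms(1,2)] has_path_derivative_component[OF assms(1,3)]
  by (metis DERIV_unique vec_eq_iff)

lemma sum_abs_powr_derivative:
  fixes c :: "real \<Rightarrow> real ^ 'd"
  assumes "q > 1" and "\<And>k. ((\<lambda>t. c t $ k) has_real_derivative w $ k) (at 0)"
  shows "((\<lambda>t. \<Sum>k\<in>UNIV. \<bar>c t $ k\<bar> powr q) has_real_derivative
     q * (signed_power (c 0) (q - 1) \<bullet> w)) (at 0)"
proof -
  have "((\<lambda>t. \<bar>c t $ k\<bar> powr q) has_real_derivative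
      q * (sgn (c 0 $ k) * \<bar>c 0 $ k\<bar> powr (q - 1)) * w $ k) (at 0)" for k
    using DERIV_chain2[OF has_real_derivative_abs_powr[OF assms(1)] assms(2)] .
  then have "((\<lambda>t. \<Sum>k\<in>UNIV. \<bar>c t $ k\<bar> powr q) has_real_derivative
      (\<Sum>k\<in>UNIV. q * (sgn (c 0 $ k) * \<bar>c 0 $ k\<bar> powr (q - 1)) * w $ k)) (at 0)"
    by (intro DERIV_sum)
  then show ?thesis
    by (simp add: inner_vec_def signed_power_def sum_distrib_left mult.assoc)
qed

lemma smallo_iff_derivative_eq_0:
  fixes f :: "real \<Rightarrow> real"
  assumes "(f has_real_derivative D) (at 0)"
  shows "(\<lambda>t. f t - f 0) \<in> o[at 0](\<lambda>t. t) \<longleftrightarrow> D = 0"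
proof
  have lim: "((\<lambda>t. (f t - f 0) / t) \<longlongrightarrow> D) (at 0)"
    using assms by (simp add: DERIV_def)
  show "D = 0" if "(\<lambda>t. f t - f 0) \<in> o[at 0](\<lambda>t. t)"
    using LIM_unique[OF lim smalloD_tendsto[OF that]] .
  show "(\<lambda>t. f t - f 0) \<in> o[at 0](\<lambda>t. t)" if "D = 0"
    using lim that by (intro smalloI_tendsto) (auto simp: eventually_at_filter)
qed

text \<open>For \<open>d \<noteq> 0\<close> the norm is differentiable, with gradient a positive
  multiple of the signed power of \<open>d\<close>. For \<open>d = 0\<close> the increment is
  \<open>\<bar>t\<bar> * lq_norm q w\<close>, whose quotient by \<open>t\<close> tends to
  \<open>lq_norm q w\<close> from the right.\<close>

lemma lq_norm_line_smallo:
  fixes d w :: "real ^ 'd"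
  assumes q: "q > 1"
  shows "(\<lambda>t. lq_norm q (d + t *\<^sub>R w) - lq_norm q d) \<in> o[at 0](\<lambda>t. t) \<longleftrightarrow>
     (if d = 0 then w = 0 else signed_power d (q - 1) \<bullet> w = 0)"
proof (cases "d = 0")
  case True
  have "(\<lambda>t. lq_norm q (d + t *\<^sub>R w) - lq_norm q d) = (\<lambda>t. \<bar>t\<bar> * lq_norm q w)"
    using q by (simp add: True lq_norm_scaleR lq_norm_0)
  moreover have "(\<lambda>t. \<bar>t\<bar> * lq_norm q w) \<in> o[at 0](\<lambda>t. t) \<longleftrightarrow> lq_norm q w = 0"
  proof
    assume "(\<lambda>t. \<bar>t\<bar> * lq_norm q w) \<in> o[at 0](\<lambda>t. t)"
    then have "((\<lambda>t. \<bar>t\<bar> * lq_norm q w / t) \<longlongrightarrow> 0) (at 0)" by (rule smalloD_tendsto)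
    then have "((\<lambda>t. \<bar>t\<bar> * lq_norm q w / t) \<longlongrightarrow> 0) (at_right 0)"
      by (rule filterlim_mono) (auto simp: at_le)
    moreover have "\<forall>\<^sub>F t::real in at_right 0. \<bar>t\<bar> * lq_norm q w / t = lq_norm q w"
      by (rule eventually_at_rightI[of 0 1]) auto
    ultimately have "((\<lambda>t::real. lq_norm q w) \<longlongrightarrow> 0) (at_right 0)"
      by (simp add: tendsto_cong)
    then show "lq_norm q w = 0" by (simp add: tendsto_const_iff)
  qed simp
  ultimately show ?thesis using True q by (simp add: lq_norm_eq_0_iff)
next
  case False
  let ?S = "\<lambda>t. \<Sum>k\<in>UNIV. \<bar>(d + t *\<^sub>R w) $ k\<bar> powr q"
  have "((\<lambda>t. (d + t *\<^sub>R w) $ k) has_real_derivative w $ k) (at 0)" for k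
    by (auto intro!: derivative_eq_intros)
  from sum_abs_powr_derivative[OF q this]
  have S: "(?S has_real_derivative q * (signed_power d (q - 1) \<bullet> w)) (at 0)"
    by simp
  have pos: "?S 0 > 0"
  proof -
    have "?S 0 = lq_norm q d powr q" using q by (simp add: lq_norm_powr)
    moreover have "lq_norm q d \<noteq> 0" using False q by (simp add: lq_norm_eq_0_iff)
    moreover have "0 \<le> lq_norm q d" by (simp add: lq_norm_def)
    ultimately show ?thesis by simp
  qed
  have "((\<lambda>t. lq_norm q (d + t *\<^sub>R w)) has_real_derivative
      (1 / q) * ?S 0 powr (1 / q - 1) * (q * (signed_power d (q - 1) \<bullet> w))) (at 0)"
    unfolding lq_norm_def by (rule DERIV_chain2[OF has_real_derivative_powr[OF pos] S])
  from smallo_iff_derivative_eq_0[OF this] show ?thesis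
    using False pos q by simp
qed

lemma infinitesimal_flex_iff:
  fixes p u :: "'v::finite \<Rightarrow> real ^ 'd"
  assumes "q > 1"
  shows "infinitesimal_flex (lq_norm q) E p u \<longleftrightarrow>
    (\<forall>i j. {i, j} \<in> E \<longrightarrow>
       (if p i = p j then u i = u j else signed_power (p i - p j) (q - 1) \<bullet> (u i - u j) = 0))"
proof -
  have eq: "(p i + t *\<^sub>R u i) - (p j + t *\<^sub>R u j) = (p i - p j) + t *\<^sub>R (u i - u j)" for i j t
    by (simp add: algebra_simps)
  show ?thesis
    unfolding infinitesimal_flex_def eq lq_norm_line_smallo[OF assms] right_minus_eq ..
qed

section \<open>Trivial flexes are translations\<close>

lemma rigid_motion_velocity:
  fixes \<gamma> :: "real ^ 'd \<Rightarrow> real \<Rightarrow> real ^ 'd"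
  assumes q: "q > 1" and rm: "rigid_motion (lq_norm q) \<gamma>"
    and "has_path_derivative_at_0 (lq_norm q) (\<gamma> x) a" "has_path_derivative_at_0 (lq_norm q) (\<gamma> y) b"
  shows "signed_power (x - y) (q - 1) \<bullet> (a - b) = 0"
proof -
  let ?c = "\<lambda>t. \<gamma> x t - \<gamma> y t"
  \<comment> \<open>The \<open>q\<close>-th power of the distance is differentiable even where the
    distance vanishes, so \<open>x = y\<close> needs no separate treatment.\<close>
  let ?S = "\<lambda>t. \<Sum>k\<in>UNIV. \<bar>?c t $ k\<bar> powr q"
  have "((\<lambda>t. ?c t $ k) has_real_derivative (a - b) $ k) (at 0)" for k
    using q assms(3,4) by (auto intro!: derivative_intros has_path_derivative_component)
  from sum_abs_powr_derivative[OF q this]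
  have D: "(?S has_real_derivative q * (signed_power (?c 0) (q - 1) \<bullet> (a - b))) (at 0)" .
  have S_eq: "?S t = ?S 0" if "t \<in> {-1<..<1}" for t
  proof -
    have "\<forall>t\<in>{-1..1}. \<forall>x y. lq_norm q (\<gamma> x t - \<gamma> y t) = lq_norm q (x - y)"
      using rm unfolding rigid_motion_def by blast
    then have "lq_norm q (?c t) = lq_norm q (x - y)" "lq_norm q (?c 0) = lq_norm q (x - y)"
      using that by auto
    then have "lq_norm q (?c t) powr q = lq_norm q (?c 0) powr q" by metis
    then show ?thesis using q by (simp only: lq_norm_powr)
  qed
  have "\<forall>\<^sub>F t in nhds 0. t \<in> {-1<..<1::real}"
    by (rule eventually_nhds_in_open) auto
  then have ev: "\<forall>\<^sub>F t in nhds 0. ?S t = ?S 0"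
    by (rule eventually_mono) (rule S_eq)
  have "q * (signed_power (?c 0) (q - 1) \<bullet> (a - b)) = 0"
    by (rule DERIV_unique[OF DERIV_cong_ev[OF refl ev refl, THEN iffD1, OF D] DERIV_const])
  moreover have "?c 0 = x - y" using rm by (simp add: rigid_motion_def)
  ultimately show ?thesis using q by simp
qed

text \<open>The first coordinate of such a field depends only on the second coordinate of the point and
  vice versa; comparing the increments over steps 1 and 2 gives \<open>2 powr r * B = 2 * B\<close>.\<close>

lemma orthogonal_field_constant:
  fixes V :: "real ^ 2 \<Rightarrow> real ^ 2"
  assumes r: "r > 0" "r \<noteq> 1"
    and orth: "\<And>x y. signed_power (x - y) r \<bullet> (V x - V y) = 0"
  shows "V x = V y"
proof -
  define f g where "f s t = V (vector [s, t]) $ 1" and "g s t = V (vector [s, t]) $ 2" for s t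
  have *: "sgn (s - s') * \<bar>s - s'\<bar> powr r * (f s t - f s' t')
      + sgn (t - t') * \<bar>t - t'\<bar> powr r * (g s t - g s' t') = 0" for s s' t t'
    using orth[of "vector [s, t]" "vector [s', t']"]
    by (simp add: inner_vec_def sum_2 signed_power_def f_def g_def)
  have f: "f s t = f 0 t" for s t
    using *[of s 0 t t] by (cases "s = 0") (auto simp: sgn_zero_iff)
  have g: "g s t = g s 0" for s t
    using *[of s s t 0] by (cases "t = 0") (auto simp: sgn_zero_iff)
  have two: "2 powr r \<noteq> (2::real)"
    using r powr_inj[of 2 r 1] by simp
  \<comment> \<open>With the horizontal step fixed at 1, the increment of \<open>f 0\<close> over
    \<open>h\<close> is \<open>h powr r\<close> times a constant that does not depend on
    \<open>t\<close>.\<close>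
  have inc: "f 0 (t + h) - f 0 t + h powr r * (g 1 0 - g 0 0) = 0" if "h > 0" for t h
    using *[of 1 0 "t + h" t] that f[of 1 "t + h"] g[of 1 "t + h"] g[of 0 t] by simp
  have "2 powr r * (g 1 0 - g 0 0) = 2 * (g 1 0 - g 0 0)"
    using inc[of 1 0] inc[of 1 1] inc[of 2 0] by simp
  then have "(2 powr r - 2) * (g 1 0 - g 0 0) = 0" by (simp only: left_diff_distrib)
  then have g0: "g 1 0 - g 0 0 = 0" using two by simp
  then have f_step: "f 0 (t + h) = f 0 t" if "h > 0" for t h
    using inc[OF that, of t] by simp
  have f_const: "f s t = f 0 0" for s t
  proof -
    have "f 0 t = f 0 0"
      using f_step[of t 0] f_step[of "- t" t] by (cases t "0::real" rule: linorder_cases) auto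
    then show ?thesis using f[of s t] by metis
  qed
  have g_step: "g (s + h) 0 = g s 0" if "h > 0" for s h
    using *[of "s + h" s 1 0] that f_const[of "s + h" 1] f_const[of s 0] g[of "s + h" 1] by simp
  have g_const: "g s t = g 0 0" for s t
  proof -
    have "g s 0 = g 0 0"
      using g_step[of s 0] g_step[of "- s" s] by (cases s "0::real" rule: linorder_cases) auto
    then show ?thesis using g[of s t] by metis
  qed
  have vec: "vector [x $ 1, x $ 2] = x" for x :: "real ^ 2"
    by (simp add: vec_eq_iff forall_2)
  have "V x = V 0" for x
    using f_const[of "x $ 1" "x $ 2"] g_const[of "x $ 1" "x $ 2"] f_const[of "(0::real^2) $ 1" "(0::real^2) $ 2"]
      g_const[of "(0::real^2) $ 1" "(0::real^2) $ 2"]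
    unfolding f_def g_def vec by (simp add: vec_eq_iff forall_2)
  then show ?thesis by metis
qed

lemma translation_rigid_motion:
  fixes c :: "real ^ 'd"
  assumes q: "q > 0"
  shows "rigid_motion (lq_norm q) (\<lambda>x t. x + t *\<^sub>R c)"
    and "has_path_derivative_at_0 (lq_norm q) (\<lambda>t. x + t *\<^sub>R c) c"
proof -
  show der: "has_path_derivative_at_0 (lq_norm q) (\<lambda>t. x + t *\<^sub>R c) c" for x
  proof -
    have "\<forall>\<^sub>F t in at 0. lq_norm q ((x + t *\<^sub>R c - (x + 0 *\<^sub>R c)) /\<^sub>R t - c) = 0"
      by (auto simp: eventually_at_filter lq_norm_0)
    then show ?thesis
      unfolding has_path_derivative_at_0_def by (rule tendsto_eventually)
  qed
  have "continuous_path (lq_norm q) (\<lambda>t. x + t *\<^sub>R c)" for x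
    unfolding continuous_path_def
  proof
    fix t :: real
    have "lq_norm q (x + s *\<^sub>R c - (x + t *\<^sub>R c)) = \<bar>s - t\<bar> * lq_norm q c" for s
      using lq_norm_scaleR[OF q, of "s - t" c] by (simp add: algebra_simps)
    moreover have "((\<lambda>s. \<bar>s - t\<bar> * lq_norm q c) \<longlongrightarrow> \<bar>t - t\<bar> * lq_norm q c) (at t within {-1..1})"
      by (intro tendsto_intros)
    ultimately show "((\<lambda>s. lq_norm q (x + s *\<^sub>R c - (x + t *\<^sub>R c))) \<longlongrightarrow> 0) (at t within {-1..1})"
      by simp
  qed
  then show "rigid_motion (lq_norm q) (\<lambda>x t. x + t *\<^sub>R c)"
    using der by (auto simp: rigid_motion_def)
qed

text \<open>A rigid motion moves every point of the plane, so its velocity field is orthogonal for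
  all pairs of points and must be constant wherever \<open>p\<close> places the vertices.\<close>

lemma trivial_flex_iff:
  fixes p u :: "'v::finite \<Rightarrow> real ^ 2"
  assumes q: "q > 1" "q \<noteq> 2"
  shows "trivial_flex (lq_norm q) p u \<longleftrightarrow> (\<forall>i j. u i = u j)"
proof
  assume "trivial_flex (lq_norm q) p u"
  then obtain \<gamma> where \<gamma>: "rigid_motion (lq_norm q) \<gamma>"
    "\<And>i. has_path_derivative_at_0 (lq_norm q) (\<gamma> (p i)) (u i)"
    by (auto simp: trivial_flex_def)
  from \<gamma>(1) have "\<forall>x. \<exists>v. has_path_derivative_at_0 (lq_norm q) (\<gamma> x) v"
    by (simp add: rigid_motion_def)
  then obtain V where V: "\<And>x. has_path_derivative_at_0 (lq_norm q) (\<gamma> x) (V x)" by metis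
  have "V x = V y" for x y
    by (rule orthogonal_field_constant[of "q - 1"])
       (use q rigid_motion_velocity[OF q(1) \<gamma>(1) V V] in auto)
  moreover have "u i = V (p i)" for i
    using has_path_derivative_unique[OF _ \<gamma>(2) V] q by simp
  ultimately show "\<forall>i j. u i = u j" by simp
next
  assume u: "\<forall>i j. u i = u j"
  define c where "c = u undefined"
  have "u i = c" for i using u by (simp add: c_def)
  then show "trivial_flex (lq_norm q) p u"
    using q unfolding trivial_flex_def
    by (intro exI[of _ "\<lambda>x t. x + t *\<^sub>R c"]) (simp add: translation_rigid_motion)
qed

section \<open>Independence of the rows of the rigidity matrix\<close>

text \<open>Taken from the one-edge graph, so that the same vector represents an edge in every edge
  set containing it.\<close>

definition edge_row :: "real \<Rightarrow> ('v::finite \<Rightarrow> real ^ 'd) \<Rightarrow> 'v set \<Rightarrow> real ^ ('v \<times> 'd)" where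
  "edge_row q p e = rigidity_matrix q {e} p $ e"

definition flatten :: "('v::finite \<Rightarrow> real ^ 'd) \<Rightarrow> real ^ ('v \<times> 'd)" where
  "flatten u = (\<chi> c. u (fst c) $ snd c)"

text \<open>Independence of a family: the image set alone would not notice equal rows of different
  edges.\<close>

definition row_independent :: "real \<Rightarrow> ('v::finite \<Rightarrow> real ^ 'd) \<Rightarrow> 'v set set \<Rightarrow> bool" where
  "row_independent q p F \<longleftrightarrow> inj_on (edge_row q p) F \<and> independent (edge_row q p ` F)"

lemma row_independent_subset: "row_independent q p F \<Longrightarrow> G \<subseteq> F \<Longrightarrow> row_independent q p G"
  unfolding row_independent_def by (meson image_mono independent_mono inj_on_subset)

lemma flatten_surj: "\<exists>u. y = flatten u"
  by (rule exI[of _ "\<lambda>v. \<chi> k. y $ (v, k)"]) (simp add: flatten_def vec_eq_iff)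

lemma rank_rigidity_matrix_edge_row: "rank (rigidity_matrix q E p) = dim (edge_row q p ` E)"
proof -
  have "row e (rigidity_matrix q E p) = edge_row q p e" if "e \<in> E" for e
    using that by (auto simp: row_def edge_row_def rigidity_matrix_def vec_eq_iff)
  then show ?thesis by (simp add: rank_rigidity_matrix)
qed

lemma edge_row_component:
  assumes "i \<noteq> j"
  shows "edge_row q p {i, j} $ (v, k) =
    signed_power (p i - p j) (q - 1) $ k * ((if v = i then 1 else 0) - (if v = j then 1 else 0))"
  using rigidity_matrix_edge[OF assms, of "{{i, j}}" q p v k] assms by (simp add: edge_row_def)

lemma edge_row_inner:
  fixes p u :: "'v::finite \<Rightarrow> real ^ 'd"
  assumes "i \<noteq> j"
  shows "edge_row q p {i, j} \<bullet> flatten u = signed_power (p i - p j) (q - 1) \<bullet> (u i - u j)"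
proof -
  let ?s = "signed_power (p i - p j) (q - 1)"
  have "edge_row q p {i, j} \<bullet> flatten u =
      (\<Sum>c\<in>UNIV \<times> UNIV. edge_row q p {i, j} $ c * u (fst c) $ snd c)"
    by (simp add: inner_vec_def flatten_def)
  also have "\<dots> = (\<Sum>v\<in>UNIV. \<Sum>k\<in>UNIV. edge_row q p {i, j} $ (v, k) * u v $ k)"
    by (simp add: sum.cartesian_product case_prod_unfold)
  also have "\<dots> = (\<Sum>k\<in>UNIV. \<Sum>v\<in>UNIV. ?s $ k * ((if v = i then u v $ k else 0) - (if v = j then u v $ k else 0)))"
    by (subst sum.swap) (auto intro!: sum.cong simp: edge_row_component[OF assms])
  also have "\<dots> = (\<Sum>k\<in>UNIV. ?s $ k * (u i $ k - u j $ k))"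
    by (simp add: sum_distrib_left[symmetric] sum_subtractf)
  finally show ?thesis by (simp add: inner_vec_def)
qed

lemma infinitesimal_flex_kernel:
  fixes p u :: "'v::finite \<Rightarrow> real ^ 'd"
  assumes q: "q > 1" and E: "simple_graph E" and u: "infinitesimal_flex (lq_norm q) E p u" and e: "e \<in> E"
  shows "edge_row q p e \<bullet> flatten u = 0"
proof -
  obtain i j where ij: "i \<noteq> j" "e = {i, j}" using E e by (auto simp: simple_graph_def)
  then show ?thesis using u e q
    by (cases "p i = p j") (auto simp: edge_row_inner infinitesimal_flex_iff)
qed

lemma kernel_infinitesimal_flex:
  fixes p u :: "'v::finite \<Rightarrow> real ^ 'd"
  assumes q: "q > 1" and E: "simple_graph E"
    and ker: "\<And>e. e \<in> E \<Longrightarrow> edge_row q p e \<bullet> flatten u = 0"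
    and degenerate: "\<And>i j. {i, j} \<in> E \<Longrightarrow> p i = p j \<Longrightarrow> u i = u j"
  shows "infinitesimal_flex (lq_norm q) E p u"
  unfolding infinitesimal_flex_iff[OF q]
proof (intro allI impI)
  fix i j assume e: "{i, j} \<in> E"
  then have "i \<noteq> j" using E by (force simp: simple_graph_def doubleton_eq_iff)
  then show "if p i = p j then u i = u j else signed_power (p i - p j) (q - 1) \<bullet> (u i - u j) = 0"
    using ker[OF e] degenerate[OF e] by (simp add: edge_row_inner)
qed

text \<open>A coordinate of the velocity of \<open>v\<close> relative to \<open>w\<close>, as a
  functional. For fixed \<open>w\<close> these span the orthogonal complement of the translations,
  where all rows lie.\<close>

definition difference_axis :: "'v::finite \<Rightarrow> 'v \<Rightarrow> 'd::finite \<Rightarrow> real ^ ('v \<times> 'd)" where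
  "difference_axis w v k = axis (v, k) 1 - axis (w, k) 1"

lemma difference_axis_inner: "difference_axis w v k \<bullet> flatten u = u v $ k - u w $ k"
  by (simp add: difference_axis_def inner_diff_left inner_axis' flatten_def)

lemma edge_row_in_span:
  fixes p :: "'v::finite \<Rightarrow> real ^ 'd"
  assumes "i \<noteq> j" "i \<in> W" "j \<in> W"
  shows "edge_row q p {i, j} \<in> span ((\<lambda>(v, k). difference_axis w v k) ` ((W - {w}) \<times> UNIV))" (is "_ \<in> span ?D")
proof -
  have D: "difference_axis w v k \<in> span ?D" if "v \<in> W" for v and k :: 'd
  proof (cases "v = w")
    case True
    then show ?thesis by (simp add: difference_axis_def span_zero)
  next
    case False
    then have "(v, k) \<in> (W - {w}) \<times> UNIV" using that by simp
    then have "difference_axis w v k \<in> ?D" by (rule rev_image_eqI) simp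
    then show ?thesis by (rule span_base)
  qed
  have "edge_row q p {i, j} =
      (\<Sum>k\<in>UNIV. signed_power (p i - p j) (q - 1) $ k *\<^sub>R (difference_axis w i k - difference_axis w j k))"
  proof -
    have "edge_row q p {i, j} $ (v, l) =
      (\<Sum>k\<in>UNIV. signed_power (p i - p j) (q - 1) $ k *\<^sub>R (difference_axis w i k - difference_axis w j k)) $ (v, l)" for v l
    proof -
      have "(\<Sum>k\<in>UNIV. signed_power (p i - p j) (q - 1) $ k *\<^sub>R (difference_axis w i k - difference_axis w j k)) $ (v, l)
        = (\<Sum>k\<in>UNIV. if k = l then signed_power (p i - p j) (q - 1) $ k *
             ((if v = i then 1 else 0) - (if v = j then 1 else 0)) else 0)"
        unfolding sum_component by (rule sum.cong) (auto simp: difference_axis_def axis_def)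
      then show ?thesis by (simp add: edge_row_component[OF assms(1)])
    qed
    then show ?thesis by (simp add: vec_eq_iff)
  qed
  also have "\<dots> \<in> span ?D"
    by (intro span_sum span_scale span_diff D assms)
  finally show ?thesis .
qed

text \<open>The rows lie in a space spanned by the \<open>2 * (card W - 1)\<close> coordinates of
  velocities relative to \<open>w\<close>. If the bound is attained they span it, so a field
  orthogonal to them has no relative velocity on \<open>W\<close>.\<close>

lemma row_independent_count:
  fixes p :: "'v::finite \<Rightarrow> real ^ 2"
  assumes ind: "row_independent q p F" and F: "simple_graph F" "\<And>e. e \<in> F \<Longrightarrow> e \<subseteq> W" and w: "w \<in> W"
  shows "card F + 2 \<le> 2 * card W"
    and "card F + 2 = 2 * card W \<Longrightarrow> (\<And>e. e \<in> F \<Longrightarrow> edge_row q p e \<bullet> flatten u = 0) \<Longrightarrow> v \<in> W \<Longrightarrow> u v = u w"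
proof -
  let ?R = "edge_row q p ` F"
  let ?D = "(\<lambda>(v, k). difference_axis w v k) ` ((W - {w}) \<times> UNIV) :: (real ^ ('v \<times> 2)) set"
  have "edge_row q p e \<in> span ?D" if e: "e \<in> F" for e
  proof -
    obtain i j where "i \<noteq> j" "e = {i, j}" using F(1) e by (auto simp: simple_graph_def)
    then show ?thesis using F(2)[OF e] edge_row_in_span[of i j W q p w] by simp
  qed
  then have RD: "?R \<subseteq> span ?D" by blast
  have cardR: "card ?R = card F" "independent ?R"
    using ind by (auto simp: row_independent_def card_image)
  have "card ?D \<le> card ((W - {w}) \<times> (UNIV :: 2 set))" by (intro card_image_le) simp
  also have "\<dots> = 2 * (card W - 1)" using w by (simp add: card_cartesian_product)
  finally have cardD: "card ?D + 2 \<le> 2 * card W"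
    using w card_gt_0_iff[of W] by auto
  have "card ?R \<le> card ?D"
    using independent_span_bound[OF _ cardR(2) RD] by simp
  then show "card F + 2 \<le> 2 * card W" using cardD cardR by simp
  show "u v = u w" if tight: "card F + 2 = 2 * card W"
    and ker: "\<And>e. e \<in> F \<Longrightarrow> edge_row q p e \<bullet> flatten u = 0" and v: "v \<in> W"
  proof -
    have "dim (span ?D) \<le> card ?R"
      using dim_le_card'[of ?D] cardD tight cardR by simp
    then have "span ?D \<subseteq> span ?R"
      using card_ge_dim_independent[OF RD cardR(2)] by blast
    have "u v $ k = u w $ k" for k
    proof (cases "v = w")
      case False
      then have "(v, k) \<in> (W - {w}) \<times> UNIV" using v by simp
      then have "difference_axis w v k \<in> ?D" by (rule rev_image_eqI) simp
      then have "difference_axis w v k \<in> span ?R"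
        by (intro subsetD[OF \<open>span ?D \<subseteq> span ?R\<close>] span_base)
      then have "orthogonal (flatten u) (difference_axis w v k)"
        by (rule orthogonal_to_span) (auto simp: orthogonal_def inner_commute[of "flatten u"] ker)
      then show ?thesis
        by (simp add: orthogonal_def inner_commute[of "flatten u"] difference_axis_inner)
    qed simp
    then show ?thesis by (simp add: vec_eq_iff)
  qed
qed

text \<open>Rank and nullity: the kernel lies in the two-dimensional space of constant fields,
  inside a space of dimension \<open>2 * CARD('v)\<close>.\<close>

lemma kernel_constant_count:
  fixes p :: "'v::finite \<Rightarrow> real ^ 2"
  assumes "\<And>u. (\<And>e. e \<in> F \<Longrightarrow> edge_row q p e \<bullet> flatten u = 0) \<Longrightarrow> \<forall>i j. u i = u j"
  shows "2 * CARD('v) \<le> card F + 2"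
proof -
  let ?R = "edge_row q p ` F"
  let ?K = "{y \<in> UNIV. \<forall>x\<in>span ?R. orthogonal x y}"
  let ?C = "(\<lambda>k::2. flatten (\<lambda>_::'v. axis k 1)) ` UNIV"
  have "?K \<subseteq> span ?C"
  proof
    fix y assume y: "y \<in> ?K"
    obtain u where u: "y = flatten u" using flatten_surj by blast
    have "edge_row q p e \<bullet> flatten u = 0" if "e \<in> F" for e
    proof -
      have "edge_row q p e \<in> span ?R" using that by (intro span_base imageI)
      then show ?thesis using y unfolding u orthogonal_def by blast
    qed
    then have "\<forall>i j. u i = u j" by (rule assms)
    then have const: "u i = u j" for i j by blast
    have "y = (\<Sum>k\<in>UNIV. u undefined $ k *\<^sub>R flatten (\<lambda>_. axis k 1))"
      unfolding u vec_eq_iff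
    proof
      fix c :: "'v \<times> 2"
      have "(\<Sum>k\<in>UNIV. u undefined $ k *\<^sub>R flatten (\<lambda>_::'v. axis k (1::real))) $ c
          = (\<Sum>k\<in>UNIV. if k = snd c then u undefined $ k else 0)"
        unfolding sum_component by (rule sum.cong) (auto simp: flatten_def axis_def)
      then show "flatten u $ c = (\<Sum>k\<in>UNIV. u undefined $ k *\<^sub>R flatten (\<lambda>_. axis k 1)) $ c"
        using const[of "fst c" undefined] by (simp add: flatten_def)
    qed
    also have "\<dots> \<in> span ?C"
      by (intro span_sum span_scale span_base) simp
    finally show "y \<in> span ?C" .
  qed
  then have "dim ?K \<le> card ?C" by (intro dim_le_card) auto
  also have "\<dots> \<le> 2" using card_image_le[of "UNIV :: 2 set"] by simp
  finally have "dim ?K \<le> 2" .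
  moreover have "dim ?K + dim (span ?R) = dim (UNIV :: (real ^ ('v \<times> 2)) set)"
    by (rule dim_subspace_orthogonal_to_vectors) auto
  moreover have "dim (span ?R) \<le> card F"
    using dim_le_card'[of ?R] card_image_le[of F "edge_row q p"] by simp
  ultimately show ?thesis by (simp add: dim_UNIV)
qed

section \<open>Dual velocity fields; independence, sparsity and regular placements\<close>

lemma row_independent_if_dual:
  fixes p :: "'v::finite \<Rightarrow> real ^ 'd"
  assumes dual: "\<And>e. e \<in> F \<Longrightarrow> \<exists>u. \<forall>d\<in>F. edge_row q p d \<bullet> flatten u = (if d = e then 1 else 0)"
  shows "row_independent q p F"
  unfolding row_independent_def
proof
  show inj: "inj_on (edge_row q p) F"
  proof (rule inj_onI)
    fix e d assume ed: "e \<in> F" "d \<in> F" "edge_row q p e = edge_row q p d"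
    obtain u where u: "\<forall>d\<in>F. edge_row q p d \<bullet> flatten u = (if d = e then 1 else 0)"
      using dual[OF ed(1)] by blast
    show "e = d"
    proof (rule ccontr)
      assume "e \<noteq> d"
      then show False using u[rule_format, OF ed(1)] u[rule_format, OF ed(2)] ed(3) by auto
    qed
  qed
  show "independent (edge_row q p ` F)"
    unfolding dependent_def
  proof
    assume "\<exists>a\<in>edge_row q p ` F. a \<in> span (edge_row q p ` F - {a})"
    then obtain e where e: "e \<in> F" "edge_row q p e \<in> span (edge_row q p ` F - {edge_row q p e})" by blast
    obtain u where u: "\<forall>d\<in>F. edge_row q p d \<bullet> flatten u = (if d = e then 1 else 0)"
      using dual[OF e(1)] by blast
    have "orthogonal (flatten u) (edge_row q p e)"
      by (rule orthogonal_to_span[OF e(2)]) (use u in \<open>auto simp: orthogonal_def inner_commute\<close>)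
    then show False using u e(1) by (simp add: orthogonal_def inner_commute)
  qed
qed

text \<open>The separating field is the component of the row of \<open>e\<close> orthogonal to the
  span of the other rows.\<close>

lemma row_independent_separate:
  fixes p :: "'v::finite \<Rightarrow> real ^ 'd"
  assumes ind: "row_independent q p F" and e: "e \<in> F"
  obtains u where "\<And>d. d \<in> F - {e} \<Longrightarrow> edge_row q p d \<bullet> flatten u = 0" "edge_row q p e \<bullet> flatten u \<noteq> 0"
proof -
  let ?S = "edge_row q p ` (F - {e})"
  have "?S = edge_row q p ` F - {edge_row q p e}"
    using ind e by (auto simp: row_independent_def inj_on_def)
  then have notin: "edge_row q p e \<notin> span ?S"
    using ind e unfolding row_independent_def dependent_def by auto
  obtain y z where yz: "y \<in> span ?S" "\<And>w. w \<in> span ?S \<Longrightarrow> orthogonal z w" "edge_row q p e = y + z"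
    using orthogonal_subspace_decomp_exists by blast
  have "z \<noteq> 0" using notin yz by auto
  have "z \<bullet> y = 0" using yz(1,2) by (simp add: orthogonal_def)
  then have "edge_row q p e \<bullet> z \<noteq> 0"
    using \<open>z \<noteq> 0\<close> unfolding yz(3) inner_add_left inner_commute[of y z] by simp
  moreover have "edge_row q p d \<bullet> z = 0" if "d \<in> F - {e}" for d
    using yz(2)[of "edge_row q p d"] that by (simp add: orthogonal_def span_base inner_commute)
  ultimately show thesis using that flatten_surj[of z] by metis
qed

text \<open>Every vertex is its own block, and an injective numbering orients the edges, as the
  block graphs consist of ordered pairs. Solvability then yields fields dual to the rows.\<close>

lemma sparse_imp_row_independent:
  fixes F :: "'v::finite set set"
  assumes q: "1 < q" "q \<noteq> 2" and F: "simple_graph F" and sparse: "sparse22 F"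
  shows "\<exists>p :: 'v \<Rightarrow> real ^ 2. row_independent q p F"
proof -
  obtain h :: "'v \<Rightarrow> nat" where h: "inj h"
    using finite_imp_inj_to_nat_seg[of "UNIV :: 'v set"] by auto
  define D where "D = {(i, j). {i, j} \<in> F \<and> h i < h j}"
  have "asym D" by (auto simp: D_def intro!: asymI)
  moreover have "block_sparse D id UNIV"
    unfolding block_sparse_def
  proof (intro conjI ballI allI impI)
    fix W :: "'v set" assume W: "W \<subseteq> UNIV" "W \<noteq> {}"
    let ?F = "{e\<in>F. e \<subseteq> W}"
    have "card (inner_edges D id W) \<le> card ?F"
    proof (rule card_inj_on_le)
      show "inj_on (\<lambda>(i, j). {i, j}) (inner_edges D id W)"
        by (auto simp: inj_on_def inner_edges_def D_def doubleton_eq_iff)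
      show "(\<lambda>(i, j). {i, j}) ` inner_edges D id W \<subseteq> ?F"
        by (auto simp: inner_edges_def D_def)
    qed simp
    moreover have "int (card ?F) \<le> 2 * int (card W) - 2"
      using sparse[unfolded sparse22_def, rule_format, of W ?F] W(2) by (simp add: subgraph_of_def)
    ultimately show "card (inner_edges D id W) + 2 \<le> 2 * card W" by linarith
  qed auto
  ultimately obtain x0 where "\<forall>i. 0 < x0 i" "solvable (q - 1) D id x0"
    using block_sparse_solvable[of "q - 1" UNIV D id] q by auto
  then have "generic (solvable (q - 1) D id)" using solvable_generic by blast
  \<comment> \<open>A solvable placement may put vertices at the same point; genericity makes the
    abscissae distinct, so the factor relating a row to \<open>edge_value\<close> is
    nonzero.\<close>
  from generic_witness[OF generic_conj[OF this generic_sum_inj]] obtain x where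
    x: "\<forall>i. 0 < x i" "solvable (q - 1) D id x" "\<forall>a b c d. x a + x b = x c + x d \<longrightarrow> {a, b} = {c, d}"
    by (elim exE conjE)
  have x_inj: "x i \<noteq> x j" if "i \<noteq> j" for i j
    using x(3)[rule_format, of i i j j] that by auto
  define p :: "'v \<Rightarrow> real ^ 2" where "p i = vector [x i, (x i)\<^sup>2]" for i
  have row_value: "signed_power (p i - p j) (q - 1) \<bullet> (vector [f i, g i] - vector [f j, g j]) =
      sgn (x i - x j) * \<bar>x i - x j\<bar> powr (q - 1) * edge_value (q - 1) x id f g (i, j)" for i j f g
  proof -
    have sq: "(x i)\<^sup>2 - (x j)\<^sup>2 = (x i - x j) * (x i + x j)"
      by (simp add: power2_eq_square algebra_simps)
    have pos: "x i + x j > 0" using x(1) by (simp add: add_pos_pos)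
    have second: "sgn ((x i)\<^sup>2 - (x j)\<^sup>2) * \<bar>(x i)\<^sup>2 - (x j)\<^sup>2\<bar> powr (q - 1)
        = sgn (x i - x j) * \<bar>x i - x j\<bar> powr (q - 1) * (x i + x j) powr (q - 1)"
      unfolding sq using pos by (simp add: sgn_mult abs_mult powr_mult)
    show ?thesis
      by (simp add: inner_vec_def sum_2 signed_power_def p_def edge_value_def second distrib_left mult.assoc)
  qed
  have "row_independent q p F"
  proof (rule row_independent_if_dual)
    fix e assume e: "e \<in> F"
    \<comment> \<open>Division by that factor turns the value of the row of \<open>e\<close> into
      1.\<close>
    define \<tau> where "\<tau> d = (if {fst d, snd d} = e then
      1 / (sgn (x (fst d) - x (snd d)) * \<bar>x (fst d) - x (snd d)\<bar> powr (q - 1)) else 0)" for d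
    obtain f g where fg: "\<forall>d\<in>D. edge_value (q - 1) x id f g d = \<tau> d"
      using x(2) unfolding solvable_def by blast
    have "edge_row q p d \<bullet> flatten (\<lambda>i. vector [f i, g i]) = (if d = e then 1 else 0)" if d: "d \<in> F" for d
    proof -
      obtain i j where ij: "i \<noteq> j" "d = {i, j}" "h i < h j"
      proof -
        obtain i j where "i \<noteq> j" "d = {i, j}" using F d by (auto simp: simple_graph_def)
        moreover from this have "h i \<noteq> h j" using h by (auto dest: injD)
        ultimately show thesis
          using that[of i j] that[of j i] by (cases "h i < h j") (auto simp: insert_commute)
      qed
      then have "(i, j) \<in> D" using d by (simp add: D_def)
      then have "edge_row q p d \<bullet> flatten (\<lambda>i. vector [f i, g i]) =
          sgn (x i - x j) * \<bar>x i - x j\<bar> powr (q - 1) * \<tau> (i, j)"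
        using fg by (simp add: ij edge_row_inner row_value)
      then show ?thesis using x_inj[OF ij(1)] by (simp add: \<tau>_def ij(2) sgn_zero_iff)
    qed
    then show "\<exists>u. \<forall>d\<in>F. edge_row q p d \<bullet> flatten u = (if d = e then 1 else 0)" by blast
  qed
  then show ?thesis by blast
qed

lemma row_independent_imp_sparse:
  fixes p :: "'v::finite \<Rightarrow> real ^ 2"
  assumes "row_independent q p F" "simple_graph F"
  shows "sparse22 F"
  unfolding sparse22_def
proof (intro allI impI)
  fix W :: "'v set" and G assume W: "W \<noteq> {} \<and> subgraph_of W G F"
  then obtain w where "w \<in> W" by blast
  have G: "G \<subseteq> F" "\<And>e. e \<in> G \<Longrightarrow> e \<subseteq> W" using W by (auto simp: subgraph_of_def)
  have "simple_graph G" using G assms(2) by (auto simp: simple_graph_def)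
  from row_independent_count(1)[OF row_independent_subset[OF assms(1) G(1)] this G(2) \<open>w \<in> W\<close>]
  show "int (card G) \<le> 2 * int (card W) - 2" by linarith
qed

text \<open>Regularity transfers the rank of the placement constructed for \<open>F\<close> to the
  given \<open>p\<close>.\<close>

lemma regular_rank_ge:
  fixes p :: "'v::finite \<Rightarrow> real ^ 2"
  assumes q: "1 < q" "q \<noteq> 2" and E: "simple_graph E" and reg: "regular q E p"
    and F: "F \<subseteq> E" "sparse22 F"
  shows "card F \<le> dim (edge_row q p ` E)"
proof -
  have "simple_graph F" using E F by (auto simp: simple_graph_def)
  then obtain p' :: "'v \<Rightarrow> real ^ 2" where p': "row_independent q p' F"
    using sparse_imp_row_independent[OF q _ F(2)] by blast
  then have "card F = dim (edge_row q p' ` F)"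
    by (simp add: row_independent_def dim_eq_card_independent card_image)
  also have "\<dots> \<le> dim (edge_row q p' ` E)"
    using F by (intro dim_subset image_mono)
  also have "\<dots> \<le> dim (edge_row q p ` E)"
    using reg unfolding regular_def rank_rigidity_matrix_edge_row by blast
  finally show ?thesis .
qed

lemma row_basis_exists:
  fixes p :: "'v::finite \<Rightarrow> real ^ 'd"
  obtains B where "B \<subseteq> E" "row_independent q p B" "edge_row q p ` E \<subseteq> span (edge_row q p ` B)"
    "card B = dim (edge_row q p ` E)"
proof -
  obtain R where R: "R \<subseteq> edge_row q p ` E" "independent R" "edge_row q p ` E \<subseteq> span R"
    "card R = dim (edge_row q p ` E)"
    using basis_exists by blast
  obtain B where B: "B \<subseteq> E" "inj_on (edge_row q p) B" "R = edge_row q p ` B"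
    using R(1) by (meson subset_image_inj)
  show thesis
    using that[OF B(1)] R B by (simp add: row_independent_def card_image)
qed

text \<open>An edge with coinciding endpoints contributes a zero row but forces \<open>u i = u j\<close>. At a
  regular placement this condition is already implied by the other rows: the edge closes a circuit of
  the sparsity matroid with a row basis.\<close>

lemma regular_kernel_degenerate_edge:
  fixes p u :: "'v::finite \<Rightarrow> real ^ 2"
  assumes q: "1 < q" "q \<noteq> 2" and E: "simple_graph E" and reg: "regular q E p"
    and ker: "\<And>e. e \<in> E \<Longrightarrow> edge_row q p e \<bullet> flatten u = 0"
    and e: "{i, j} \<in> E" and deg: "p i = p j"
  shows "u i = u j"
proof -
  have ij: "i \<noteq> j" using E e by (force simp: simple_graph_def doubleton_eq_iff)
  obtain B where B: "B \<subseteq> E" "row_independent q p B" "card B = dim (edge_row q p ` E)"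
    using row_basis_exists by metis
  have "signed_power (p i - p j) (q - 1) = 0" using deg by (simp add: signed_power_def vec_eq_iff)
  then have zero: "edge_row q p {i, j} = 0"
    using edge_row_component[OF ij, of q p] by (simp add: vec_eq_iff)
  have eB: "{i, j} \<notin> B"
  proof
    assume "{i, j} \<in> B"
    then have "0 \<in> edge_row q p ` B" using zero by (metis image_eqI)
    then show False using B(2) dependent_zero unfolding row_independent_def by blast
  qed
  have simpB: "simple_graph B" using E B(1) by (auto simp: simple_graph_def)
  \<comment> \<open>Otherwise the rank at \<open>p\<close> would exceed
    \<open>card B\<close>.\<close>
  have "\<not> sparse22 (insert {i, j} B)"
  proof
    assume "sparse22 (insert {i, j} B)"
    then have "card (insert {i, j} B) \<le> dim (edge_row q p ` E)"
      using regular_rank_ge[OF q E reg, of "insert {i, j} B"] B(1) e by simp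
    then show False using B(3) eB by simp
  qed
  then obtain W G where W: "W \<noteq> {}" "subgraph_of W G (insert {i, j} B)"
    "\<not> int (card G) \<le> 2 * int (card W) - 2"
    unfolding sparse22_def by blast
  have eG: "{i, j} \<in> G"
  proof (rule ccontr)
    assume "{i, j} \<notin> G"
    then have "subgraph_of W G B" using W(2) unfolding subgraph_of_def by blast
    then show False
      using row_independent_imp_sparse[OF B(2) simpB] W(1,3) unfolding sparse22_def by blast
  qed
  let ?G = "G - {{i, j}}"
  have G: "?G \<subseteq> B" "\<And>e. e \<in> ?G \<Longrightarrow> e \<subseteq> W" and ijW: "i \<in> W" "j \<in> W"
    using W(2) eG unfolding subgraph_of_def by auto
  have sG: "simple_graph ?G" using simpB G(1) by (auto simp: simple_graph_def)
  note count = row_independent_count[OF row_independent_subset[OF B(2) G(1)] sG G(2) ijW(2)]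
  \<comment> \<open>\<open>G\<close> violates the bound while \<open>?G\<close> obeys it, so
    \<open>?G\<close> is tight on a set containing \<open>i\<close> and \<open>j\<close>, and the
    equality case of the count applies.\<close>
  have "card G = Suc (card ?G)" using eG by (metis card.remove finite)
  then have "card ?G + 2 = 2 * card W" using count(1) W(3) by linarith
  moreover have "edge_row q p e \<bullet> flatten u = 0" if "e \<in> ?G" for e
    using that G(1) B(1) ker by blast
  ultimately show ?thesis using count(2)[of u i] ijW(1) by blast
qed

lemma regular_infinitesimal_flex_iff:
  fixes p u :: "'v::finite \<Rightarrow> real ^ 2"
  assumes q: "1 < q" "q \<noteq> 2" and E: "simple_graph E" and reg: "regular q E p"
  shows "infinitesimal_flex (lq_norm q) E p u \<longleftrightarrow> (\<forall>e\<in>E. edge_row q p e \<bullet> flatten u = 0)"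
  using infinitesimal_flex_kernel[OF q(1) E]
    kernel_infinitesimal_flex[OF q(1) E] regular_kernel_degenerate_edge[OF q E reg]
  by metis

theorem theorem3p6:
  fixes q :: real and E :: "'v::finite set set" and p :: "'v \<Rightarrow> real ^ 2"
  assumes "1 < q" and "q \<noteq> 2"
    and "simple_graph E" and "connected_graph E"
    and "regular q E p"
  shows "minimally_infinitesimally_rigid (lq_norm q) E p \<longleftrightarrow> tight22 E"
proof
  note q = assms(1,2) and E = assms(3) and reg = assms(5)
  have simple_sub: "simple_graph F" if "F \<subseteq> E" for F
    using that E by (auto simp: simple_graph_def)
  note flex_iff = regular_infinitesimal_flex_iff[OF q E reg]
  note trivial_iff = trivial_flex_iff[OF q, of p]
  show "tight22 E" if min: "minimally_infinitesimally_rigid (lq_norm q) E p"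
  proof -
    obtain B where B: "B \<subseteq> E" "row_independent q p B" "edge_row q p ` E \<subseteq> span (edge_row q p ` B)"
      by (rule row_basis_exists)
    have const: "\<forall>i j. u i = u j" if ker: "\<And>e. e \<in> B \<Longrightarrow> edge_row q p e \<bullet> flatten u = 0" for u
    proof -
      have "edge_row q p e \<bullet> flatten u = 0" if "e \<in> E" for e
      proof -
        have "edge_row q p e \<in> span (edge_row q p ` B)" using B(3) that by blast
        then have "orthogonal (flatten u) (edge_row q p e)"
          by (rule orthogonal_to_span) (auto simp: orthogonal_def inner_commute[of "flatten u"] ker)
        then show ?thesis by (simp add: orthogonal_def inner_commute)
      qed
      then have "infinitesimal_flex (lq_norm q) E p u" using flex_iff by blast
      then show ?thesis
        using min trivial_iff unfolding minimally_infinitesimally_rigid_def infinitesimally_rigid_def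
        by blast
    qed
    have "B = E"
    proof (rule ccontr)
      assume "B \<noteq> E"
      then obtain e where e: "e \<in> E" "B \<subseteq> E - {e}" using B(1) by blast
      \<comment> \<open>\<open>p\<close> need not be regular for \<open>E - {e}\<close>, but only
        the passage from flexes to the kernel is used here, and it holds at every placement.\<close>
      have "infinitesimally_rigid (lq_norm q) (E - {e}) p"
        unfolding infinitesimally_rigid_def
      proof (intro allI impI)
        fix u assume u: "infinitesimal_flex (lq_norm q) (E - {e}) p u"
        have "edge_row q p d \<bullet> flatten u = 0" if "d \<in> B" for d
          using infinitesimal_flex_kernel[OF q(1) simple_sub u] e(2) that by blast
        then show "trivial_flex (lq_norm q) p u" using const trivial_iff by blast
      qed
      then show False using min e(1) unfolding minimally_infinitesimally_rigid_def by blast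
    qed
    then have ind: "row_independent q p E" using B(2) by simp
    have "card E + 2 \<le> 2 * CARD('v)"
      using row_independent_count(1)[OF ind E, of UNIV] by simp
    moreover have "2 * CARD('v) \<le> card E + 2"
      using kernel_constant_count[of E q p] const unfolding \<open>B = E\<close> by blast
    ultimately show ?thesis
      using row_independent_imp_sparse[OF ind E] unfolding tight22_def by linarith
  qed
  show "minimally_infinitesimally_rigid (lq_norm q) E p" if tight: "tight22 E"
  proof -
    have sparse: "sparse22 E" and card: "card E + 2 = 2 * CARD('v)"
      using tight by (auto simp: tight22_def)
    have "card E \<le> dim (edge_row q p ` E)" by (rule regular_rank_ge[OF q E reg subset_refl sparse])
    moreover obtain B where B: "B \<subseteq> E" "row_independent q p B" "card B = dim (edge_row q p ` E)"
      using row_basis_exists by metis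
    ultimately have "B = E" by (intro card_seteq) auto
    then have ind: "row_independent q p E" using B by simp
    have rigid: "infinitesimally_rigid (lq_norm q) E p"
      unfolding infinitesimally_rigid_def
    proof (intro allI impI)
      fix u assume "infinitesimal_flex (lq_norm q) E p u"
      then have "u i = u j" for i j
        using row_independent_count(2)[OF ind E, of UNIV j u i] card flex_iff by simp
      then show "trivial_flex (lq_norm q) p u" using trivial_iff by blast
    qed
    have "\<not> infinitesimally_rigid (lq_norm q) (E - {e}) p" if e: "e \<in> E" for e
    proof
      assume rig: "infinitesimally_rigid (lq_norm q) (E - {e}) p"
      obtain u where u: "\<And>d. d \<in> E - {e} \<Longrightarrow> edge_row q p d \<bullet> flatten u = 0"
        "edge_row q p e \<bullet> flatten u \<noteq> 0"
        using row_independent_separate[OF ind e] by blast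
      \<comment> \<open>The converse passage needs a condition at edges with coinciding ends. There
        are none, since such an edge would contribute a zero vector to the independent rows of
        \<open>E\<close>.\<close>
      have "infinitesimal_flex (lq_norm q) (E - {e}) p u"
      proof (rule kernel_infinitesimal_flex[OF q(1) simple_sub u(1)])
        fix i j assume ij: "{i, j} \<in> E - {e}" "p i = p j"
        then have "i \<noteq> j" using E by (force simp: simple_graph_def doubleton_eq_iff)
        then have "edge_row q p {i, j} = 0"
          using ij(2) by (auto simp: vec_eq_iff edge_row_component signed_power_def)
        moreover have "edge_row q p {i, j} \<in> edge_row q p ` E" using ij(1) by blast
        ultimately show "u i = u j"
          using ind dependent_zero unfolding row_independent_def by metis
      qed auto
      then have const: "u i = u j" for i j
        using rig trivial_iff unfolding infinitesimally_rigid_def by blast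
      obtain i j where "i \<noteq> j" "e = {i, j}" using E e by (auto simp: simple_graph_def)
      then have "edge_row q p e \<bullet> flatten u = 0" using const[of i j] by (simp add: edge_row_inner)
      then show False using u(2) by simp
    qed
    then show ?thesis using rigid unfolding minimally_infinitesimally_rigid_def by blast
  qed
qed

end
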